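(* Let $G$ be a finite loopless multigraph of maximum degree at most $3$, each of whose edges is of one of two types, c-edges and d-edges (a pair of vertices may be joined both by a c-edge and by a d-edge). If $G$ does not contain a connected component isomorphic to $K_4$ all of whose edges are c-edges, then $G$ has a $2$-limited set $X$ with $|X| \geq |V(G)|/3$.
   Context: In such a two-type multigraph, the degree of a vertex counts edges of both types (and this degree is at most $3$). For a vertex $v$, its closed d-neighbourhood is $N_d[v] = \{v\} \cup \{u : uv \text{ is a d-edge}\}$. A set $X \subseteq V(G)$ is called $2$-limited if (i) for every c-edge $uv$, $|X \cap \{u,v\}| \leq 1$, and (ii) for every vertex $v$, $|X \cap N_d[v]| \leq 2$. (c-edges do not contribute to $N_d[v]$, and $X$ may contain both endpoints of a d-edge.) *)

theory Defs
  imports Complex_Main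
begin

text \<open>Edges are abstract objects with a set of two end vertices, so any number of parallel edges,
  of equal or different types, is allowed.\<close>

record ('v, 'e) multigraph =
  verts :: "'v set"
  edges :: "'e set"
  ends :: "'e \<Rightarrow> 'v set"

datatype edge_type = CEdge | DEdge

record ('v, 'e) typed_multigraph = "('v, 'e) multigraph" +
  etype :: "'e \<Rightarrow> edge_type"

locale finite_loopless_multigraph =
  fixes G :: "('v, 'e, 'm) multigraph_scheme"
  assumes finite_verts: "finite (verts G)"
    and finite_edges: "finite (edges G)"
    and ends_in_verts: "e \<in> edges G \<Longrightarrow> ends G e \<subseteq> verts G"
    and loopless: "e \<in> edges G \<Longrightarrow> card (ends G e) = 2"

definition degree :: "('v, 'e, 'm) multigraph_scheme \<Rightarrow> 'v \<Rightarrow> nat" where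
  "degree G v = card {e \<in> edges G. v \<in> ends G e}"

definition adjacent :: "('v, 'e, 'm) multigraph_scheme \<Rightarrow> 'v \<Rightarrow> 'v \<Rightarrow> bool" where
  "adjacent G u v \<longleftrightarrow> (\<exists>e \<in> edges G. ends G e = {u, v})"

definition induced_subgraph ::
  "('v, 'e, 'm) multigraph_scheme \<Rightarrow> 'v set \<Rightarrow> ('v, 'e, 'm) multigraph_scheme" where
  "induced_subgraph G W = G\<lparr>verts := W, edges := {e \<in> edges G. ends G e \<subseteq> W}\<rparr>"

definition components ::
  "('v, 'e, 'm) multigraph_scheme \<Rightarrow> ('v, 'e, 'm) multigraph_scheme set" where
  "components G =
    {induced_subgraph G {v \<in> verts G. (adjacent G)\<^sup>*\<^sup>* u v} | u. u \<in> verts G}"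

text \<open>Isomorphism of the underlying multigraphs: multiplicities are preserved, edge types are
  ignored.\<close>

definition isomorphic ::
  "('v, 'e, 'm) multigraph_scheme \<Rightarrow> ('w, 'f, 'n) multigraph_scheme \<Rightarrow> bool" where
  "isomorphic G H \<longleftrightarrow>
    (\<exists>f g. bij_betw f (verts G) (verts H) \<and> bij_betw g (edges G) (edges H) \<and>
      (\<forall>e \<in> edges G. ends H (g e) = f ` ends G e))"

definition complete_graph :: "nat \<Rightarrow> (nat, nat set) multigraph" where
  "complete_graph n =
    \<lparr>verts = {..<n}, edges = {e. e \<subseteq> {..<n} \<and> card e = 2}, ends = (\<lambda>e. e)\<rparr>"

definition closed_d_nbhd :: "('v, 'e, 'm) typed_multigraph_scheme \<Rightarrow> 'v \<Rightarrow> 'v set" where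
  "closed_d_nbhd G v =
    {v} \<union> {u. \<exists>e \<in> edges G. etype G e = DEdge \<and> ends G e = {u, v}}"

definition two_limited :: "('v, 'e, 'm) typed_multigraph_scheme \<Rightarrow> 'v set \<Rightarrow> bool" where
  "two_limited G X \<longleftrightarrow>
    X \<subseteq> verts G \<and>
    (\<forall>e \<in> edges G. etype G e = CEdge \<longrightarrow> card (X \<inter> ends G e) \<le> 1) \<and>
    (\<forall>v \<in> verts G. card (X \<inter> closed_d_nbhd G v) \<le> 2)"

end

theory Submission imports Defs begin

text \<open>
Only the c-neighbours and the d-neighbours of each vertex matter, so let \<open>C v\<close> and \<open>D v\<close> be these sets and
induct on the number of vertices. Every step deletes a set \<open>S\<close> and selects a set \<open>Y \<subseteq> S\<close> with
\<open>|S| \<le> 3 |Y|\<close>. Deleted edges leave room for new c-edges on the remaining vertices, which express what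
the deleted stars still demand.

If some d-edge \<open>vw\<close> has no parallel c-edge, take \<open>Y = {v, w}\<close> and \<open>S\<close> (up to a correction for common
d-neighbours) the union of the two closed neighbourhoods. If the new c-edges complete a \<open>K\<^sub>4\<close>, then this
\<open>K\<^sub>4\<close> hangs on few vertices and is itself part of a set that can be deleted without any new edge.

Otherwise the d-edges impose nothing and an independent set of a cubic graph without \<open>K\<^sub>4\<close> is sought. If no
two non-adjacent vertices have two common neighbours, take a shortest cycle. When it is even, \<open>Y\<close> is every
other vertex. When its length is \<open>2k + 1\<close>, one selects \<open>k - 1\<close> alternate vertices and one of the next two;
a c-edge between the outer neighbours of these two guarantees that one of them is available.
\<close>

section \<open>Independent sets in subcubic graphs\<close>

definition graph_on :: "'v set \<Rightarrow> ('v \<Rightarrow> 'v set) \<Rightarrow> bool" where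
  "graph_on V N \<longleftrightarrow> (\<forall>v\<in>V. N v \<subseteq> V - {v} \<and> (\<forall>u\<in>N v. v \<in> N u))"

definition K4_free :: "'v set \<Rightarrow> ('v \<Rightarrow> 'v set) \<Rightarrow> bool" where
  "K4_free V N \<longleftrightarrow> \<not> (\<exists>Q\<subseteq>V. card Q = 4 \<and> (\<forall>u\<in>Q. Q - {u} \<subseteq> N u))"

definition independent :: "('v \<Rightarrow> 'v set) \<Rightarrow> 'v set \<Rightarrow> bool" where
  "independent N X \<longleftrightarrow> (\<forall>v\<in>X. X \<inter> N v = {})"

lemma graph_on_subset: "graph_on V N \<Longrightarrow> v \<in> V \<Longrightarrow> u \<in> N v \<Longrightarrow> u \<in> V"
  and graph_on_irrefl: "graph_on V N \<Longrightarrow> v \<in> V \<Longrightarrow> v \<notin> N v"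
  and graph_on_sym: "graph_on V N \<Longrightarrow> v \<in> V \<Longrightarrow> u \<in> N v \<Longrightarrow> v \<in> N u"
  and graph_on_finite: "graph_on V N \<Longrightarrow> finite V \<Longrightarrow> v \<in> V \<Longrightarrow> finite (N v)"
  by (auto simp: graph_on_def intro: finite_subset)

lemma graph_on_Diff: "graph_on V N \<Longrightarrow> graph_on (V - S) (\<lambda>v. N v - S)"
  by (auto simp: graph_on_def)

lemma K4_freeD:
  assumes "K4_free V N" "Q \<subseteq> V" "card Q = 4"
  shows "\<exists>u\<in>Q. \<exists>w\<in>Q. u \<noteq> w \<and> w \<notin> N u"
proof (rule ccontr)
  assume "\<not> ?thesis"
  then have "\<forall>u\<in>Q. Q - {u} \<subseteq> N u" by auto
  then have "\<exists>Q\<subseteq>V. card Q = 4 \<and> (\<forall>u\<in>Q. Q - {u} \<subseteq> N u)"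
    by (intro exI[of _ Q] conjI assms(2,3))
  then show False using assms(1) unfolding K4_free_def by (rule notE[rotated])
qed

lemma K4_free_mono:
  "K4_free V N \<Longrightarrow> V' \<subseteq> V \<Longrightarrow> (\<And>v. v \<in> V' \<Longrightarrow> N' v \<subseteq> N v) \<Longrightarrow> K4_free V' N'"
  unfolding K4_free_def by (meson order_trans subsetD)

section \<open>Shortest cycles\<close>

text \<open>Finiteness and minimum degree two produce a cycle, and a shortest one has no chord. Of
  its minimality the last conjunct keeps only that a triangle \<open>p\<close>, \<open>q\<close>,
  \<open>r\<close> anywhere forces length three.\<close>

lemma ex_chordless_cycle:
  assumes fin: "finite V" and ne: "V \<noteq> {}" and G: "graph_on V N"
    and deg: "\<forall>v\<in>V. 2 \<le> card (N v)"
  shows "\<exists>m x. 3 \<le> m \<and> inj_on x {..<m} \<and> x ` {..<m} \<subseteq> V \<and>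
    (\<forall>i. Suc i < m \<longrightarrow> x (Suc i) \<in> N (x i)) \<and> x 0 \<in> N (x (m - 1)) \<and>
    (\<forall>i j. i < j \<longrightarrow> j < m \<longrightarrow> x j \<in> N (x i) \<longrightarrow> j = Suc i \<or> i = 0 \<and> j = m - 1) \<and>
    (\<forall>p\<in>V. \<forall>q\<in>N p. \<forall>r\<in>N q. p \<in> N r \<longrightarrow> m = 3)"
proof -
  \<comment> \<open>The closed walks that backtrack nowhere, except possibly at their base point: a shortest one is a
    cycle, and a chord would yield a shorter one.\<close>
  define P where "P m \<longleftrightarrow> 1 \<le> m \<and> (\<exists>x. (\<forall>i\<le>m. x i \<in> V) \<and> (\<forall>i<m. x (Suc i) \<in> N (x i)) \<and>
      x m = x 0 \<and> (\<forall>i. i + 2 \<le> m \<longrightarrow> x i \<noteq> x (i + 2)))" for m :: nat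
  have nxt: "\<exists>w\<in>N v. w \<noteq> u" if "v \<in> V" for u v
  proof (rule ccontr)
    assume "\<not> ?thesis"
    then have "N v \<subseteq> {u}" by auto
    then have "card (N v) \<le> 1" using card_mono[of "{u}" "N v"] by simp
    then show False using deg that by fastforce
  qed
  have "\<exists>m. P m"
  proof -
    obtain v0 where v0: "v0 \<in> V" using ne by auto
    \<comment> \<open>A state is the last edge walked, as a pair of previous and current vertex, and
      \<open>f\<close> moves on to a neighbour other than the previous vertex. The start
      \<open>(v0, v0)\<close> excludes nothing, as \<open>v0\<close> is no neighbour of
      itself.\<close>
    define f where "f = (\<lambda>(u, v). (v, SOME w. w \<in> N v \<and> w \<noteq> u))"
    define y where "y n = (f ^^ n) (v0, v0)" for n
    have f_snd: "snd (f q) \<in> N (snd q) \<and> snd (f q) \<noteq> fst q" if "snd q \<in> V" for q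
    proof -
      have "\<exists>w. w \<in> N (snd q) \<and> w \<noteq> fst q" using nxt[OF that, of "fst q"] by blast
      from someI_ex[OF this] show ?thesis by (simp add: f_def case_prod_beta)
    qed
    have f_fst: "fst (f q) = snd q" for q by (simp add: f_def split: prod.splits)
    have y_Suc: "y (Suc n) = f (y n)" for n by (simp add: y_def)
    define z where "z n = snd (y n)" for n
    have zV: "z n \<in> V" for n
    proof (induction n)
      case 0 then show ?case using v0 by (simp add: z_def y_def)
    next
      case (Suc n) then show ?case using f_snd[of "y n"] graph_on_subset[OF G, of "z n"]
        by (simp add: z_def y_Suc)
    qed
    have zN: "z (Suc n) \<in> N (z n)" for n using f_snd[of "y n"] zV[of n] by (simp add: z_def y_Suc)
    have z2: "z n \<noteq> z (n + 2)" for n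
      using f_snd[of "y (Suc n)"] zV[of "Suc n"] f_fst[of "y n"]
      by (auto simp: z_def y_Suc)
    have "\<not> inj z" using finite_subset[of "range z" V] fin zV finite_imageD[of z UNIV] by auto
    then obtain i j where ij: "i < j" "z i = z j" unfolding inj_def by (metis linorder_neqE_nat)
    have "P (j - i)" unfolding P_def
      using ij zV zN z2 by (intro conjI exI[of _ "\<lambda>k. z (i + k)"]) (auto simp: add.assoc[symmetric])
    then show ?thesis by blast
  qed
  then obtain m where m: "P m" and mmin: "\<And>k. k < m \<Longrightarrow> \<not> P k"
    using exists_least_iff[of P] by blast
  then obtain x where x: "\<And>i. i \<le> m \<Longrightarrow> x i \<in> V" "\<And>i. i < m \<Longrightarrow> x (Suc i) \<in> N (x i)" "x m = x 0"
    "\<And>i. i + 2 \<le> m \<Longrightarrow> x i \<noteq> x (i + 2)" and m1: "1 \<le> m" unfolding P_def by auto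
  have "m \<noteq> 1" using x(2)[of 0] x(3) x(1)[of 0] graph_on_irrefl[OF G, of "x 0"] by auto
  moreover have "m \<noteq> 2" using x(4)[of 0] x(3) by (metis add_0 order_refl)
  ultimately have m3: "3 \<le> m" using m1 by linarith
  have inj': "x i \<noteq> x j" if "i < j" "j < m" for i j
  proof
    assume eq: "x i = x j"
    have "P (j - i)" unfolding P_def
    proof (intro conjI exI[of _ "\<lambda>k. x (i + k)"] allI impI)
      fix k assume "k + 2 \<le> j - i"
      then show "x (i + k) \<noteq> x (i + (k + 2))" using that x(4)[of "i + k"] by (simp add: add.assoc)
    qed (use that eq x in auto)
    then show False using mmin[of "j - i"] that by auto
  qed
  have inj: "inj_on x {..<m}" by (auto intro!: linorder_inj_onI simp: inj')
  have chord: "j = Suc i \<or> i = 0 \<and> j = m - 1" if "i < j" "j < m" "x j \<in> N (x i)" for i j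
  proof (rule ccontr)
    assume c: "\<not> ?thesis"
    \<comment> \<open>Follow the cycle from \<open>x i\<close> to \<open>x j\<close> and return
      along the chord. As \<open>j \<noteq> Suc i\<close>, this does not backtrack, and
      \<open>i = 0\<close>, \<open>j = m - 1\<close> is the only pair for which it is not shorter
      than the cycle.\<close>
    define y where "y k = (if k \<le> j - i then x (i + k) else x i)" for k
    have "x i \<in> N (x j)" using that graph_on_sym[OF G _ that(3)] x(1)[of i] by auto
    have "P (Suc (j - i))" unfolding P_def
    proof (intro conjI exI[of _ y] allI impI)
      fix k assume "k < Suc (j - i)"
      then consider "k < j - i" | "k = j - i" by linarith
      then show "y (Suc k) \<in> N (y k)"
        by cases (use that \<open>x i \<in> N (x j)\<close> x(2)[of "i + k"] in \<open>auto simp: y_def\<close>)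
    next
      fix k assume k: "k + 2 \<le> Suc (j - i)"
      then consider "k + 2 \<le> j - i" | "Suc k = j - i" by linarith
      then show "y k \<noteq> y (k + 2)"
      proof cases
        case 1 then show ?thesis using that x(4)[of "i + k"] by (auto simp: y_def add.assoc)
      next
        case 2
        moreover have "j \<noteq> Suc i" using c by blast
        ultimately have "0 < k" "i + k < m" using that by linarith+
        then show ?thesis using 2 inj'[of i "i + k"] by (auto simp: y_def)
      qed
    qed (use that x in \<open>auto simp: y_def\<close>)
    moreover have "Suc (j - i) < m" using that(1,2) c by arith
    ultimately show False using mmin by blast
  qed
  have tri: "m = 3" if "p \<in> V" "q \<in> N p" "r \<in> N q" "p \<in> N r" for p q r
  proof -
    have V: "q \<in> V" "r \<in> V" using that graph_on_subset[OF G] by auto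
    have d: "q \<noteq> p" "r \<noteq> q" "p \<noteq> r" using that V graph_on_irrefl[OF G] by auto
    define y where "y k = (if k = 1 then q else if k = 2 then r else p)" for k :: nat
    have "P 3" unfolding P_def
    proof (intro conjI exI[of _ y] allI impI)
      fix k :: nat assume "k < 3"
      then consider "k = 0" | "k = 1" | "k = 2" by linarith
      then show "y (Suc k) \<in> N (y k)" by cases (use that in \<open>auto simp: y_def\<close>)
    next
      fix k :: nat assume "k + 2 \<le> 3"
      then consider "k = 0" | "k = 1" by linarith
      then show "y k \<noteq> y (k + 2)" by cases (use d in \<open>auto simp: y_def\<close>)
    qed (use that V in \<open>auto simp: y_def\<close>)
    then show ?thesis using mmin[of 3] m3 by (meson le_antisym not_le)
  qed
  have "x 0 \<in> N (x (m - 1))" using x(2)[of "m - 1"] x(3) m3 by simp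
  then show ?thesis
    by (intro exI[of _ m] exI[of _ x]) (use m3 inj x(1,2) chord tri in auto)
qed

section \<open>Independent sets with a third of the vertices\<close>

text \<open>The last hypothesis forbids edges from \<open>Y\<close> to \<open>X\<close>, not to all
  of \<open>V - S\<close>: on an odd cycle a selected vertex may have a neighbour that survives the
  deletion, provided that it is not selected later.\<close>

lemma extend_independent:
  assumes "finite V" "graph_on V N" "S \<subseteq> V" "Y \<subseteq> S" "card S \<le> 3 * card Y"
    and "X \<subseteq> V - S" "independent N X" "card (V - S) \<le> 3 * card X"
    and "\<And>y. y \<in> Y \<Longrightarrow> N y \<inter> (X \<union> Y) = {}"
  shows "\<exists>X\<subseteq>V. independent N X \<and> card V \<le> 3 * card X"
proof (intro exI[of _ "X \<union> Y"] conjI)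
  show "X \<union> Y \<subseteq> V" using assms by auto
  have "False" if "x \<in> X" "y \<in> Y" "y \<in> N x" for x y
    using assms(9)[of y] that graph_on_sym[OF assms(2), of x y] assms(6) by blast
  then show "independent N (X \<union> Y)" using assms(7,9) unfolding independent_def by blast
  have "card V = card (V - S) + card S"
    using assms(1,3) by (metis card_Diff_subset card_mono finite_subset le_add_diff_inverse2)
  moreover have "card (X \<union> Y) = card X + card Y"
    using assms by (intro card_Un_disjoint) (auto intro: finite_subset)
  ultimately show "card V \<le> 3 * card (X \<union> Y)" using assms by linarith
qed

text \<open>All pairs among the four vertices other than \<open>u\<close>, \<open>w\<close> are
  adjacent, so an edge \<open>uw\<close> would complete a K4.\<close>

lemma K4_free_common_neighbours:
  assumes "K4_free V N" and G: "graph_on V N" and V: "u \<in> V" "w \<in> V"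
    and "u \<noteq> w" "p \<noteq> q" "{p, q} \<subseteq> N u \<inter> N w" "q \<in> N p"
  shows "w \<notin> N u"
proof
  assume uw: "w \<in> N u"
  have pq: "p \<in> V" "q \<in> V" using assms(7) V graph_on_subset[OF G] by blast+
  have ne: "p \<noteq> u" "p \<noteq> w" "q \<noteq> u" "q \<noteq> w" using assms(7) V graph_on_irrefl[OF G] by blast+
  have adj: "p \<in> N u" "q \<in> N u" "p \<in> N w" "q \<in> N w" using assms(7) by auto
  note sym = graph_on_sym[OF G]
  have sym: "u \<in> N w" "u \<in> N p" "u \<in> N q" "w \<in> N p" "w \<in> N q" "p \<in> N q"
    using sym[OF V(1) uw] sym[OF V(1) adj(1)] sym[OF V(1) adj(2)] sym[OF V(2) adj(3)]
      sym[OF V(2) adj(4)] sym[OF pq(1) \<open>q \<in> N p\<close>] by simp_all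
  have "card {u, w, p, q} = 4" using \<open>u \<noteq> w\<close> \<open>p \<noteq> q\<close> ne by simp
  moreover have "\<forall>v\<in>{u, w, p, q}. {u, w, p, q} - {v} \<subseteq> N v"
    using adj sym uw \<open>q \<in> N p\<close> by auto
  moreover have "{u, w, p, q} \<subseteq> V" using V pq by simp
  ultimately show False using assms(1) unfolding K4_free_def by metis
qed

theorem independent_third:
  assumes "finite V" "graph_on V N" "\<And>v. v \<in> V \<Longrightarrow> card (N v) \<le> 3" "K4_free V N"
  shows "\<exists>X\<subseteq>V. independent N X \<and> card V \<le> 3 * card X"
  using assms
proof (induction "card V" arbitrary: V N rule: less_induct)
  case less
  note fin = less.prems(1) and G = less.prems(2) and deg = less.prems(3) and K4 = less.prems(4)
  note sub = graph_on_subset[OF G] and irr = graph_on_irrefl[OF G] and sym = graph_on_sym[OF G]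
  have finN: "finite (N v)" if "v \<in> V" for v using graph_on_finite[OF G fin that] .
  \<comment> \<open>Deletion without new edges: all neighbours of the selected \<open>Y\<close> lie
    in \<open>S\<close>, so any independent set of the remaining induced subgraph can be united with
    \<open>Y\<close>.\<close>
  have delete: ?case
    if S: "S \<subseteq> V" "S \<noteq> {}" and Y: "Y \<subseteq> S" "card S \<le> 3 * card Y" "\<And>y. y \<in> Y \<Longrightarrow> N y \<subseteq> S - Y" for S Y
  proof -
    have "\<exists>X\<subseteq>V - S. independent (\<lambda>v. N v - S) X \<and> card (V - S) \<le> 3 * card X"
    proof (rule less.hyps)
      show "card (V - S) < card V" using S fin by (intro psubset_card_mono) auto
      show "card (N v - S) \<le> 3" if "v \<in> V - S" for v
        using deg[of v] that finN[of v] by (meson DiffD1 Diff_subset card_mono order_trans)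
    qed (use fin G K4 in \<open>auto intro: graph_on_Diff K4_free_mono\<close>)
    then obtain X where X: "X \<subseteq> V - S" "independent (\<lambda>v. N v - S) X" "card (V - S) \<le> 3 * card X"
      by blast
    have "independent N X" using X(1,2) unfolding independent_def by blast
    then show ?thesis using extend_independent[OF fin G S(1) Y(1,2) X(1) _ X(3)] Y(3) X(1) by blast
  qed
  show ?case
  proof (cases "V = {}")
    case True then show ?thesis by (auto simp: independent_def)
  next
    case V_ne: False
    show ?thesis
    proof (cases "\<exists>v\<in>V. card (N v) \<le> 2")
      case True
      then obtain v where v: "v \<in> V" "card (N v) \<le> 2" by blast
      show ?thesis
        by (rule delete[of "insert v (N v)" "{v}"])
          (use v irr[of v] sub[of v] finN[of v] in \<open>auto simp: card_insert_if\<close>)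
    next
      case False
      then have deg3: "card (N v) = 3" if "v \<in> V" for v using deg[OF that] that by force
      show ?thesis
      proof (cases "\<exists>v\<in>V. \<exists>w\<in>V. v \<noteq> w \<and> w \<notin> N v \<and> 2 \<le> card (N v \<inter> N w)")
        case True
        then obtain v w where vw: "v \<in> V" "w \<in> V" "v \<noteq> w" "w \<notin> N v" "2 \<le> card (N v \<inter> N w)"
          by blast
        have "v \<notin> N w" using vw sym by blast
        \<comment> \<open>Two shared neighbours bring the union of the closed neighbourhoods down to
          six vertices, which pays for selecting both \<open>v\<close> and \<open>w\<close>.\<close>
        have "card (N v \<union> N w) + card (N v \<inter> N w) = 6"
          using card_Un_Int[of "N v" "N w"] finN deg3 vw by simp
        then have "card (N v \<union> N w) \<le> 4" using vw by linarith
        then have "card (insert v (insert w (N v \<union> N w))) \<le> 6"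
          using finN vw by (simp add: card_insert_if)
        then show ?thesis
          by (intro delete[of "insert v (insert w (N v \<union> N w))" "{v, w}"])
            (use vw \<open>v \<notin> N w\<close> irr sub in auto)
      next
        case False
        then have common: "card (N v \<inter> N w) < 2" if "v \<in> V" "w \<in> V" "v \<noteq> w" "w \<notin> N v" for v w
          using that by force
        \<comment> \<open>If \<open>p\<close> and \<open>q\<close> are adjacent, K4-freeness makes
          \<open>u\<close> and \<open>w\<close> non-adjacent; two non-adjacent vertices with two
          common neighbours contradict \<open>common\<close>.\<close>
        have diamond: False if "u \<in> V" "w \<in> V" "u \<noteq> w" "p \<noteq> q" "{p, q} \<subseteq> N u \<inter> N w"
          "w \<notin> N u \<or> q \<in> N p" for u w p q
        proof -
          have "w \<notin> N u" using K4_free_common_neighbours[OF K4 G that(1-5)] that(6) by blast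
          moreover have "2 \<le> card (N u \<inter> N w)"
            using card_mono[OF _ that(5)] finN that by simp
          ultimately show False using common[of u w] that by simp
        qed
        have deg2: "\<forall>v\<in>V. 2 \<le> card (N v)" using deg3 by simp
        obtain m x where m: "3 \<le> m" and inj: "inj_on x {..<m}" and xV: "x ` {..<m} \<subseteq> V"
          and cycle: "\<forall>i. Suc i < m \<longrightarrow> x (Suc i) \<in> N (x i)" "x 0 \<in> N (x (m - 1))"
            "\<forall>i j. i < j \<longrightarrow> j < m \<longrightarrow> x j \<in> N (x i) \<longrightarrow> j = Suc i \<or> i = 0 \<and> j = m - 1"
            "\<forall>p\<in>V. \<forall>q\<in>N p. \<forall>r\<in>N q. p \<in> N r \<longrightarrow> m = 3"
          using ex_chordless_cycle[OF fin V_ne G deg2] by (elim exE conjE) (rule that)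
        note step = cycle(1)[rule_format] and close = cycle(2) and chord = cycle(3)[rule_format]
          and tri = cycle(4)[rule_format]
        define Z where "Z = x ` {..<m}"
        have cardZ: "card Z = m" using inj by (simp add: Z_def card_image)
        have xi: "x i \<in> Z" "x i \<in> V" if "i < m" for i using that xV by (auto simp: Z_def)
        have xeq: "x i = x j \<longleftrightarrow> i = j" if "i < m" "j < m" for i j
          using inj_on_eq_iff[OF inj] that by simp
        have pred: "x i \<in> N (x (Suc i))" if "Suc i < m" for i using sym[OF _ step[OF that]] xi that by auto
        \<comment> \<open>Two of the three neighbours of a cycle vertex lie on the cycle. The two
          ends of the index range are separate cases because indices are not taken modulo
          \<open>m\<close>.\<close>
        have out: "card (N y - Z) \<le> 1" if y: "y \<in> Z" for y
        proof -
          obtain i where i: "i < m" "y = x i" using y by (auto simp: Z_def)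
          have "\<exists>p q. p \<noteq> q \<and> {p, q} \<subseteq> N y \<inter> Z"
          proof -
            consider "i = 0" | "i = m - 1" | "0 < i" "Suc i < m" using i by linarith
            then show ?thesis
            proof cases
              case 1
              then show ?thesis using m i step[of 0] sym[OF _ close] xi xeq
                by (intro exI[of _ "x 1"] exI[of _ "x (m - 1)"]) auto
            next
              case 2
              then show ?thesis using m i pred[of "m - 2"] close xi xeq
                by (intro exI[of _ "x (m - 2)"] exI[of _ "x 0"]) (auto simp: numeral_2_eq_2 Suc_diff_Suc)
            next
              case 3
              then show ?thesis using i pred[of "i - 1"] step[of i] xi xeq
                by (intro exI[of _ "x (i - 1)"] exI[of _ "x (Suc i)"]) auto
            qed
          qed
          then obtain p q where "p \<noteq> q" "{p, q} \<subseteq> N y \<inter> Z" by blast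
          then have "2 \<le> card (N y \<inter> Z)" using card_mono[of "N y \<inter> Z" "{p, q}"] finN xi i by simp
          moreover have "card (N y) = card (N y - Z) + card (N y \<inter> Z)"
            using finN[of y] xi i by (metis card_Int_Diff add.commute)
          ultimately show ?thesis using deg3 xi i by simp
        qed
        \<comment> \<open>The first \<open>l\<close> even positions of the cycle. The bound
          \<open>2 * l \<le> Suc m\<close> keeps the last one, \<open>2 * (l - 1)\<close>, below
          \<open>m\<close>; for independence \<open>2 * l \<le> m\<close> is required, since
          otherwise position \<open>m - 1\<close> could be selected together with its neighbour at
          position 0.\<close>
        define Y where "Y l = x ` (\<lambda>i. 2 * i) ` {..<l}" for l
        define S where "S l = Z \<union> (\<Union>y\<in>Y l. N y - Z)" for l
        have cardY: "card (Y l) = l" if "2 * l \<le> Suc m" for l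
        proof -
          have "inj_on x ((\<lambda>i. 2 * i) ` {..<l})" using that by (intro inj_on_subset[OF inj]) auto
          moreover have "card ((\<lambda>i. 2 * i) ` {..<l}) = l" by (subst card_image) (auto simp: inj_on_def)
          ultimately show ?thesis unfolding Y_def by (simp only: card_image)
        qed
        have YZ: "Y l \<subseteq> Z" if "2 * l \<le> Suc m" for l using that by (auto simp: Y_def Z_def)
        have cardS: "card (S l) \<le> m + l" if l: "2 * l \<le> Suc m" for l
        proof -
          have "finite (Y l)" by (simp add: Y_def)
          then have "card (\<Union>y\<in>Y l. N y - Z) \<le> (\<Sum>y\<in>Y l. card (N y - Z))" by (rule card_UN_le)
          also have "\<dots> \<le> (\<Sum>y\<in>Y l. 1)" using out YZ[OF l] by (intro sum_mono) auto
          finally have "card (\<Union>y\<in>Y l. N y - Z) \<le> l" using cardY[OF l] by simp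
          then show ?thesis using card_Un_le[of Z "\<Union>y\<in>Y l. N y - Z"] cardZ unfolding S_def by linarith
        qed
        have SV: "S l \<subseteq> V" if "2 * l \<le> Suc m" for l
        proof -
          have "Z \<subseteq> V" using xV by (simp add: Z_def)
          then show ?thesis using YZ[OF that] sub unfolding S_def by blast
        qed
        have Yind: "N y \<inter> Y l = {}" if l: "2 * l \<le> m" and y: "y \<in> Y l" for y l
        proof (rule ccontr)
          assume "\<not> ?thesis"
          then obtain i j where ij: "i < l" "j < l" "x (2 * i) \<in> N (x (2 * j))"
            using y by (auto simp: Y_def)
          then have "i \<noteq> j" using l irr[of "x (2 * j)"] xi(2)[of "2 * j"] by auto
          moreover have False if "a < b" "b < l" "x (2 * b) \<in> N (x (2 * a))" for a b
          proof -
            have "2 * a < 2 * b" "2 * b < m" "2 * b \<noteq> Suc (2 * a)" "2 * b \<noteq> m - 1"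
              using that(1,2) l by presburger+
            then show ?thesis using chord that(3) by blast
          qed
          moreover have "x (2 * j) \<in> N (x (2 * i))" using sym[OF _ ij(3)] xi(2)[of "2 * j"] ij l by simp
          ultimately show False using ij by (metis linorder_neqE_nat)
        qed
        show ?thesis
        proof (cases "even m")
          case True
          then obtain k where k: "m = 2 * k" by (elim evenE)
          show ?thesis
          proof (rule delete[of "S k" "Y k"])
            show "card (S k) \<le> 3 * card (Y k)" using cardS[of k] cardY[of k] k by simp
            show "N y \<subseteq> S k - Y k" if "y \<in> Y k" for y using Yind[of k y] that k by (auto simp: S_def)
          qed (use SV[of k] YZ[of k] k xi(1)[of 0] m in \<open>auto simp: S_def\<close>)
        next
          case False
          then obtain k where k: "m = 2 * k + 1" by (elim oddE)
          then obtain j where j: "m = 2 * j + 3" using m by (cases k) auto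
          \<comment> \<open>The even positions below \<open>2 * j\<close> are selected for certain,
            and one of \<open>p\<close>, \<open>q\<close> is added at the end. The deleted set
            \<open>T\<close> has at most \<open>m + j = 3 * (j + 1)\<close> vertices, which pays for
            \<open>j + 1\<close> selected ones.\<close>
          define p where "p = x (2 * j)"
          define q where "q = x (Suc (2 * j))"
          define Op where "Op = N p - Z"
          define Oq where "Oq = N q - Z"
          define T where "T = S j"
          have pq: "p \<in> Z" "q \<in> Z" "p \<in> V" "q \<in> V" "p \<noteq> q"
            using j xi xeq by (auto simp: p_def q_def)
          have qNp: "q \<in> N p" using step[of "2 * j"] j by (simp add: p_def q_def Suc_diff_Suc)
          have ZT: "Z \<subseteq> T" by (simp add: T_def S_def)
          have TV: "T \<subseteq> V" using SV[of j] j by (simp add: T_def)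
          have Op1: "s = t" if "s \<in> Op" "t \<in> Op" for s t
            using out[OF pq(1)] that finN[OF pq(3)] by (auto simp: Op_def card_le_Suc0_iff_eq)
          have Oq1: "s = t" if "s \<in> Oq" "t \<in> Oq" for s t
            using out[OF pq(2)] that finN[OF pq(4)] by (auto simp: Oq_def card_le_Suc0_iff_eq)
          have Nsym: "p \<in> N s" if "s \<in> Op" for s using that sym[OF pq(3)] by (simp add: Op_def)
          have Nsym': "q \<in> N s" if "s \<in> Oq" for s using that sym[OF pq(4)] by (simp add: Oq_def)
          \<comment> \<open>A common outer neighbour \<open>s\<close> closes a triangle with
            \<open>p\<close> and \<open>q\<close>, so the cycle is itself a triangle. Then
            \<open>s\<close> and the third cycle vertex \<open>x 2\<close> share the adjacent
            neighbours \<open>p\<close> and \<open>q\<close>, against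
            \<open>diamond\<close>.\<close>
          have disj: "Op \<inter> Oq = {}"
          proof (rule ccontr)
            assume "Op \<inter> Oq \<noteq> {}"
            then obtain s where s: "s \<in> Op" "s \<in> Oq" by blast
            have "m = 3" using tri[OF pq(3) qNp, of s] s Nsym by (auto simp: Oq_def)
            then have "j = 0" "p = x 0" "q = x 1" using j by (auto simp: p_def q_def)
            then have r: "x 2 \<in> N p" "x 2 \<in> N q" "x 2 \<in> Z" "x 2 \<in> V"
              using step[of 1] close \<open>m = 3\<close> xi[of 2] sym[of "x 2" p] by (auto simp: numeral_2_eq_2)
            have "s \<in> V" "s \<noteq> x 2" using s r sub[OF pq(3)] by (auto simp: Op_def)
            moreover have "{p, q} \<subseteq> N s \<inter> N (x 2)"
              using Nsym Nsym' s sym[OF pq(3) r(1)] sym[OF pq(4) r(2)] by auto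
            ultimately show False using diamond[OF _ r(4) _ pq(5)] qNp by blast
          qed
          \<comment> \<open>\<open>Op\<close> and \<open>Oq\<close> have at most one element each,
            so at most one edge is added. Its ends have lost \<open>p\<close> and \<open>q\<close>
            respectively, which keeps all degrees at most three; \<open>disj\<close> keeps it from
            being a loop.\<close>
          define N' where "N' v = (N v - T) \<union>
            (if v \<in> Op then Oq - T else if v \<in> Oq then Op - T else {})" for v
          have N'_iff: "y \<in> N' v \<longleftrightarrow>
              (y \<in> N v \<or> v \<in> Op \<and> y \<in> Oq \<or> v \<in> Oq \<and> y \<in> Op) \<and> y \<notin> T" for y v
          proof -
            have "v \<in> Op \<Longrightarrow> v \<notin> Oq" using disj by blast
            then show ?thesis unfolding N'_def by (cases "v \<in> Op"; cases "v \<in> Oq") auto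
          qed
          have "\<exists>X\<subseteq>V - T. independent N' X \<and> card (V - T) \<le> 3 * card X"
          proof (rule less.hyps)
            show "card (V - T) < card V" using ZT pq fin by (intro psubset_card_mono) auto
            show "finite (V - T)" using fin by simp
            show "graph_on (V - T) N'"
              unfolding graph_on_def
            proof (intro ballI conjI)
              fix v assume v: "v \<in> V - T"
              show "N' v \<subseteq> V - T - {v}"
                using v sub[of v] irr[of v] sub[OF pq(3)] sub[OF pq(4)] disj
                by (auto simp: N'_def Op_def Oq_def split: if_splits)
              fix u assume "u \<in> N' v"
              then show "v \<in> N' u" using v sym[of v u] disj by (auto simp: N'_def split: if_splits)
            qed
            show "card (N' v) \<le> 3" if v: "v \<in> V - T" for v
            proof -
              have fT: "card (N v - T) \<le> 2" if "N v \<inter> T \<noteq> {}"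
              proof -
                have "card (N v - T) < card (N v)"
                  using that finN v by (intro psubset_card_mono) auto
                then show ?thesis using deg3 v by simp
              qed
              have le1: "card (Op - T) \<le> 1" "card (Oq - T) \<le> 1"
                using out[OF pq(1)] out[OF pq(2)] finN[OF pq(3)] finN[OF pq(4)]
                  card_mono[of Op "Op - T"] card_mono[of Oq "Oq - T"] by (auto simp: Op_def Oq_def)
              consider "v \<in> Op" | "v \<notin> Op" "v \<in> Oq" | "v \<notin> Op" "v \<notin> Oq" by blast
              then show ?thesis
              proof cases
                case 1
                then have "card (N v - T) \<le> 2" using Nsym pq ZT by (intro fT) auto
                then show ?thesis using 1 le1(2) card_Un_le[of "N v - T" "Oq - T"] by (simp add: N'_def)
              next
                case 2
                then have "card (N v - T) \<le> 2" using Nsym' pq ZT by (intro fT) auto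
                then show ?thesis using 2 le1(1) card_Un_le[of "N v - T" "Op - T"] by (simp add: N'_def)
              next
                case 3
                then show ?thesis using deg3[of v] v finN[of v] card_mono[of "N v" "N v - T"]
                  by (auto simp: N'_def)
              qed
            qed
            \<comment> \<open>A K4 of \<open>N'\<close> must use the new edge \<open>uw\<close>,
              which is missing in \<open>N\<close>. Its other edges are old, so the remaining two
              vertices are common neighbours of \<open>u\<close> and \<open>w\<close>, against
              \<open>diamond\<close>.\<close>
            show "K4_free (V - T) N'"
              unfolding K4_free_def
            proof (intro notI, elim exE conjE)
              fix Q assume Q: "Q \<subseteq> V - T" "card Q = 4" "\<forall>u\<in>Q. Q - {u} \<subseteq> N' u"
              have QV: "Q \<subseteq> V" using Q(1) by auto
              have adj: "y \<in> N' v" if "v \<in> Q" "y \<in> Q" "y \<noteq> v" for v y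
                using bspec[OF Q(3) that(1)] that by auto
              obtain u w where uw: "u \<in> Q" "w \<in> Q" "u \<noteq> w" "w \<notin> N u"
                using K4_freeD[OF K4 QV Q(2)] by metis
              have w': "w \<in> N' u" using adj uw by simp
              have "u \<notin> N w" using uw(2,4) sym[of w u] QV by auto
              have "Q - {u, w} \<subseteq> N u \<inter> N w"
              proof
                fix y assume y: "y \<in> Q - {u, w}"
                then have y': "y \<in> N' u" "y \<in> N' w" "y \<noteq> u" "y \<noteq> w" using adj[of u y] adj[of w y] uw by auto
                from w' uw(4) consider "u \<in> Op" "w \<in> Oq" | "u \<in> Oq" "w \<in> Op" unfolding N'_iff by blast
                then show "y \<in> N u \<inter> N w"
                proof cases
                  case 1
                  then have "u \<notin> Oq" "w \<notin> Op" "y \<notin> Op" "y \<notin> Oq" using disj y' Op1[of u y] Oq1[of w y] by auto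
                  then show ?thesis using y' unfolding N'_iff by simp
                next
                  case 2
                  then have "u \<notin> Op" "w \<notin> Oq" "y \<notin> Op" "y \<notin> Oq" using disj y' Op1[of w y] Oq1[of u y] by auto
                  then show ?thesis using y' unfolding N'_iff by simp
                qed
              qed
              moreover have "card (Q - {u, w}) = 2"
                using uw Q(2) by (subst card_Diff_subset) auto
              then obtain y z where "Q - {u, w} = {y, z}" "y \<noteq> z" by (auto simp: card_2_iff)
              ultimately show False using diamond[of u w y z] uw Q(1) by auto
            qed
          qed
          then obtain X where X: "X \<subseteq> V - T" "independent N' X" "card (V - T) \<le> 3 * card X" by blast
          have XN: "independent N X" using X(1,2) unfolding independent_def N'_def by blast
          have cT: "card T \<le> 3 * Suc j" using cardS[of j] j by (simp add: T_def)
          have Y0: "N y \<inter> (X \<union> Y j) = {}" if "y \<in> Y j" for y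
            using Yind[of j y] that j X(1) by (auto simp: T_def S_def)
          have Yk: "Y (Suc j) = insert p (Y j)"
          proof -
            have "{..<Suc j} = insert j {..<j}" by auto
            then show ?thesis by (simp add: Y_def p_def)
          qed
          have YT: "Y (Suc j) \<subseteq> T" using YZ[of "Suc j"] j ZT by simp
          have "s = t \<or> t \<in> N' s" if "s \<in> Op" "t \<in> Oq" "s \<in> X" "t \<in> X" for s t
            using that X(1) by (auto simp: N'_def)
          \<comment> \<open>The new edge ensures that \<open>X\<close> avoids the outer neighbour of
            \<open>p\<close> or that of \<open>q\<close>, and the corresponding cycle vertex can be
            selected.\<close>
          then consider "Op \<inter> X = {}" | "Oq \<inter> X = {}"
            using X(2) disj unfolding independent_def by blast
          then show ?thesis
          proof cases
            case 1
            have "N y \<inter> (X \<union> Y (Suc j)) = {}" if y: "y \<in> Y (Suc j)" for y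
            proof -
              have "N y \<inter> X = {}"
                using y Y0[of y] 1 X(1) ZT unfolding Yk Op_def by blast
              then show ?thesis using Yind[of "Suc j" y] y j by auto
            qed
            then show ?thesis
              using extend_independent[OF fin G TV YT _ X(1) XN X(3)] cT cardY[of "Suc j"] j by simp
          next
            case 2
            have qY: "x (2 * i) \<notin> N q" if i: "i < j" for i
            proof
              assume "x (2 * i) \<in> N q"
              then have "x (Suc (2 * j)) \<in> N (x (2 * i))" using sym[OF pq(4)] by (simp add: q_def)
              then show False using chord[of "2 * i" "Suc (2 * j)"] i j by auto
            qed
            have qY0: "N q \<inter> Y j = {}" using qY by (auto simp: Y_def)
            have "q \<notin> N y" if "y \<in> Y j" for y
              using that qY0 sym[of y q] YT pq TV unfolding Yk by blast
            then have "N y \<inter> (X \<union> insert q (Y j)) = {}" if "y \<in> insert q (Y j)" for y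
              using that Y0[of y] 2 X(1) ZT qY0 irr[OF pq(4)] unfolding Oq_def by blast
            moreover have "card (insert q (Y j)) = Suc j"
            proof -
              have "q \<notin> Y j"
              proof
                assume "q \<in> Y j"
                then obtain i where "i < j" "x (Suc (2 * j)) = x (2 * i)" by (auto simp: q_def Y_def)
                then show False using xeq[of "Suc (2 * j)" "2 * i"] j by presburger
              qed
              then show ?thesis using cardY[of j] j by (simp add: Y_def)
            qed
            moreover have "insert q (Y j) \<subseteq> T" using YT pq ZT unfolding Yk by blast
            ultimately show ?thesis
              using extend_independent[OF fin G TV _ _ X(1) XN X(3), of "insert q (Y j)"] cT by simp
          qed
        qed
      qed
    qed
  qed
qed

section \<open>Two types of edges\<close>

definition limited :: "'v set \<Rightarrow> ('v \<Rightarrow> 'v set) \<Rightarrow> ('v \<Rightarrow> 'v set) \<Rightarrow> 'v set \<Rightarrow> bool" where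
  "limited V C D X \<longleftrightarrow>
    X \<subseteq> V \<and> independent C X \<and> (\<forall>v\<in>V. card (X \<inter> insert v (D v)) \<le> 2)"

text \<open>The two degrees are added, so a pair that is joined in both \<open>C\<close> and
  \<open>D\<close> counts twice, as in the multigraph. Only \<open>C\<close> has to be K4-free; a
  reduction may add to \<open>C\<close> but only shrinks \<open>D\<close>.\<close>

locale subcubic =
  fixes V :: "'v set" and C D :: "'v \<Rightarrow> 'v set"
  assumes fin: "finite V" and C: "graph_on V C" and D: "graph_on V D"
    and degree: "v \<in> V \<Longrightarrow> card (C v) + card (D v) \<le> 3"
    and K4: "K4_free V C"
begin

lemmas C_sub = graph_on_subset[OF C] and D_sub = graph_on_subset[OF D]
  and C_irr = graph_on_irrefl[OF C] and D_irr = graph_on_irrefl[OF D]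
  and C_sym = graph_on_sym[OF C] and D_sym = graph_on_sym[OF D]
  and C_fin = graph_on_finite[OF C fin] and D_fin = graph_on_finite[OF D fin]

lemma card_D: "v \<in> V \<Longrightarrow> card (D v) \<le> 3"
  using degree[of v] by simp

lemma card_D_remove:
  assumes "v \<in> V" "u \<in> D v"
  shows "card (D v - {u}) \<le> 2"
  using card_D[OF assms(1)] assms(2) by (simp add: card_Diff_singleton)

lemma C_empty: "v \<in> V \<Longrightarrow> 3 \<le> card (D v) \<Longrightarrow> C v = {}"
  using degree[of v] card_0_eq[OF C_fin[of v]] by linarith

section \<open>Extending limited sets over a deleted set\<close>

text \<open>A vertex outside \<open>S\<close> without d-neighbours in \<open>Y\<close> meets
  \<open>X \<union> Y\<close> only in \<open>X\<close>, where limitedness on \<open>V - S\<close>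
  applies; hence \<open>star\<close> concerns the other vertices only. \<open>C'\<close> may contain
  new c-edges, as these restrict \<open>X\<close> further.\<close>

lemma extend_limited:
  assumes Y: "Y \<subseteq> S" "S \<subseteq> V" and X: "limited (V - S) C' (\<lambda>v. D v - S) X"
    and C': "\<And>v. v \<in> V - S \<Longrightarrow> C v - S \<subseteq> C' v"
    and CY: "\<And>y. y \<in> Y \<Longrightarrow> C y \<subseteq> S - Y"
    and star: "\<And>u. u \<in> V \<Longrightarrow> u \<in> S \<or> D u \<inter> Y \<noteq> {} \<Longrightarrow> card ((X \<union> Y) \<inter> insert u (D u)) \<le> 2"
  shows "limited V C D (X \<union> Y)"
  unfolding limited_def
proof (intro conjI ballI)
  have X': "X \<subseteq> V - S" "\<And>v. v \<in> X \<Longrightarrow> X \<inter> C' v = {}"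
    "\<And>v. v \<in> V - S \<Longrightarrow> card (X \<inter> insert v (D v - S)) \<le> 2"
    using X unfolding limited_def independent_def by auto
  show "X \<union> Y \<subseteq> V" using X'(1) Y by auto
  show "independent C (X \<union> Y)"
    unfolding independent_def
  proof (intro ballI)
    fix u assume "u \<in> X \<union> Y"
    then show "(X \<union> Y) \<inter> C u = {}"
    proof
      assume u: "u \<in> X"
      have "X \<inter> C u = {}" using X'(1) X'(2)[OF u] C'[of u] u by auto
      moreover have "y \<notin> C u" if "y \<in> Y" for y
        using C_sym[of u y] CY[OF that] u X'(1) by auto
      ultimately show ?thesis by auto
    next
      assume "u \<in> Y"
      then show ?thesis using CY[of u] X'(1) by auto
    qed
  qed
  fix u assume u: "u \<in> V"
  show "card ((X \<union> Y) \<inter> insert u (D u)) \<le> 2"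
  proof (cases "u \<in> S \<or> D u \<inter> Y \<noteq> {}")
    case False
    then have "(X \<union> Y) \<inter> insert u (D u) = X \<inter> insert u (D u - S)" using X'(1) Y by auto
    then show ?thesis using X'(3)[of u] u False by simp
  qed (use star u in blast)
qed

section \<open>A K4 completed by new edges\<close>

text \<open>Here \<open>Q\<close> is a \<open>K\<^sub>4\<close> in which every missing edge \<open>st\<close> is witnessed by a vertex \<open>a\<close> with \<open>D a = {s, t, h}\<close>
  and \<open>h \<in> {v, w}\<close>. Counting degrees, all neighbours of \<open>Q\<close> outside \<open>Q\<close> are such witnesses. If each vertex
  of \<open>Q\<close> has at most one, delete \<open>Q\<close>, \<open>a\<close>, \<open>h\<close> and select \<open>s\<close>, \<open>t\<close>. Otherwise let \<open>s\<close> have the most witnesses,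
  \<open>a\<close> for \<open>st\<close> and \<open>b\<close> for \<open>sx\<close> among them, delete \<open>Q\<close>, \<open>v\<close>, \<open>w\<close>, \<open>D s\<close> and select \<open>s\<close>, \<open>t\<close>, \<open>b\<close>. As \<open>v\<close>
  and \<open>w\<close> have at most four other d-neighbours, only \<open>s\<close> can have three witnesses.\<close>

lemma K4_reducible:
  assumes Q: "Q \<subseteq> V" "card Q = 4" and vw: "v \<in> V" "w \<in> D v" "v \<notin> Q" "w \<notin> Q"
    and adj: "\<And>s t. s \<in> Q \<Longrightarrow> t \<in> Q \<Longrightarrow> s \<noteq> t \<Longrightarrow> t \<notin> C s \<Longrightarrow>
      \<exists>a\<in>V - Q - {v, w}. \<exists>h\<in>{v, w}. {s, t, h} \<subseteq> D a"
  shows "\<exists>S Y. S \<subseteq> V \<and> S \<noteq> {} \<and> Y \<subseteq> S \<and> card S \<le> 3 * card Y \<and>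
    (\<forall>X. limited (V - S) (\<lambda>v. C v - S) (\<lambda>v. D v - S) X \<longrightarrow> limited V C D (X \<union> Y))"
proof -
  have wV: "w \<in> V" using vw D_sub by simp
  have finQ: "finite Q" using Q fin finite_subset by blast
  have struct: "C s \<subseteq> Q \<and>
      (\<forall>a\<in>D s. \<exists>t h. t \<in> Q \<and> t \<noteq> s \<and> t \<notin> C s \<and> h \<in> {v, w} \<and> D a = {s, t, h} \<and> a \<in> V - Q - {v, w}) \<and>
      (\<forall>a\<in>D s. \<forall>b\<in>D s. \<forall>t\<in>Q. t \<noteq> s \<longrightarrow> t \<in> D a \<longrightarrow> t \<in> D b \<longrightarrow> a = b)" if s: "s \<in> Q" for s
  proof -
    define R where "R = {t \<in> Q - {s}. t \<notin> C s}"
    define P where "P = {t \<in> Q - {s}. t \<in> C s}"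
    have "\<forall>t\<in>R. \<exists>a. a \<in> V - Q - {v, w} \<and> (\<exists>h\<in>{v, w}. {s, t, h} \<subseteq> D a)"
      using adj[OF s] by (auto simp: R_def)
    then obtain g where g: "\<And>t. t \<in> R \<Longrightarrow> g t \<in> V - Q - {v, w}"
      "\<And>t. t \<in> R \<Longrightarrow> \<exists>h\<in>{v, w}. {s, t, h} \<subseteq> D (g t)" by (metis (no_types))
    have Dg: "\<exists>h\<in>{v, w}. D (g t) = {s, t, h}" if t: "t \<in> R" for t
    proof -
      obtain h where h: "h \<in> {v, w}" "{s, t, h} \<subseteq> D (g t)" using g(2)[OF t] by auto
      have "t \<noteq> s" "h \<noteq> s" "h \<noteq> t" using t s h(1) vw by (auto simp: R_def)
      then have "card {s, t, h} = 3" by simp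
      then have "{s, t, h} = D (g t)"
        using h(2) card_D[of "g t"] g(1)[OF t] D_fin[of "g t"] by (intro card_seteq) auto
      then show ?thesis using h(1) by blast
    qed
    have g_eq: "t = t'" if "t \<in> R" "t' \<in> Q" "t' \<noteq> s" "t' \<in> D (g t)" for t t'
      using Dg[OF that(1)] that(2-4) vw by auto
    have inj: "inj_on g R"
    proof (rule inj_onI)
      fix t t' assume t: "t \<in> R" "t' \<in> R" "g t = g t'"
      then show "t = t'" using g_eq[of t t'] Dg[of t'] by (auto simp: R_def)
    qed
    have "g t \<in> D s" if "t \<in> R" for t
      using D_sym[of "g t" s] g(1)[OF that] Dg[OF that] by auto
    then have gR: "g ` R \<subseteq> D s" by auto
    have sV: "s \<in> V" using s Q by auto
    have "P \<union> R = Q - {s}" "P \<inter> R = {}" by (auto simp: P_def R_def)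
    moreover have "finite P" "finite R" using finQ by (auto simp: P_def R_def)
    ultimately have "card P + card R = 3"
      using card_Un_disjoint[of P R] s Q(2) by (simp add: card_Diff_singleton)
    moreover have PC: "P \<subseteq> C s" by (auto simp: P_def)
    moreover have "card P \<le> card (C s)" using card_mono[OF C_fin[OF sV] PC] .
    moreover have "card R \<le> card (D s)"
      using card_mono[OF D_fin[OF sV] gR] card_image[OF inj] by simp
    ultimately have "card (C s) = card P" "card (D s) = card (g ` R)"
      using degree[OF sV] card_image[OF inj] by linarith+
    then have CP: "C s = P" and Dg_eq: "D s = g ` R"
      using card_subset_eq[OF C_fin[OF sV] PC] card_subset_eq[OF D_fin[OF sV] gR] by auto
    show ?thesis
    proof (intro conjI ballI impI)
      show "C s \<subseteq> Q" using CP by (auto simp: P_def)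
    next
      fix a assume "a \<in> D s"
      then obtain t where t: "t \<in> R" "a = g t" using Dg_eq by auto
      then obtain h where "h \<in> {v, w}" "D a = {s, t, h}" using Dg by blast
      moreover have "t \<in> Q" "t \<noteq> s" "t \<notin> C s" using t by (auto simp: R_def)
      moreover have "a \<in> V - Q - {v, w}" using g(1) t by simp
      ultimately show "\<exists>t h. t \<in> Q \<and> t \<noteq> s \<and> t \<notin> C s \<and> h \<in> {v, w} \<and> D a = {s, t, h} \<and> a \<in> V - Q - {v, w}"
        by (intro exI[of _ t] exI[of _ h] conjI)
    next
      fix a b t assume "a \<in> D s" "b \<in> D s" and t: "t \<in> Q" "t \<noteq> s" "t \<in> D a" "t \<in> D b"
      then obtain t1 t2 where "t1 \<in> R" "t2 \<in> R" "a = g t1" "b = g t2" using Dg_eq by auto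
      then show "a = b" using g_eq[of t1 t] g_eq[of t2 t] t by simp
    qed
  qed
  have CQ: "C s \<subseteq> Q" if "s \<in> Q" for s using struct[OF that] by simp
  have outer: "\<exists>t h. t \<in> Q \<and> t \<noteq> s \<and> t \<notin> C s \<and> h \<in> {v, w} \<and> D a = {s, t, h} \<and> a \<in> V - Q - {v, w}"
    if "s \<in> Q" "a \<in> D s" for s a using struct[OF that(1)] that(2) by simp
  have outer_out: "a \<in> V - Q - {v, w}" if "s \<in> Q" "a \<in> D s" for s a using outer[OF that] by metis
  have uniq: "a = b" if "s \<in> Q" "t \<in> Q" "t \<noteq> s" "a \<in> D s" "b \<in> D s" "t \<in> D a" "t \<in> D b" for s t a b
    using struct[OF that(1)] that(2-) by simp
  show ?thesis
  proof (cases "\<forall>s\<in>Q. card (D s) \<le> 1")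
    case True
    obtain s a where s: "s \<in> Q" and a: "a \<in> D s"
    proof -
      obtain s t where st: "s \<in> Q" "t \<in> Q" "s \<noteq> t" "t \<notin> C s" using K4_freeD[OF K4 Q] by metis
      obtain a where "a \<in> V" "s \<in> D a" using adj[OF st] by auto
      then show ?thesis using that[OF st(1) D_sym] by simp
    qed
    obtain t h where t: "t \<in> Q" "t \<noteq> s" "t \<notin> C s" and h: "h \<in> {v, w}" and Da: "D a = {s, t, h}"
      and aV: "a \<in> V" "a \<notin> Q" "a \<noteq> v" "a \<noteq> w"
      using outer[OF s a] by auto
    have V: "s \<in> V" "t \<in> V" "h \<in> V" using s t h Q(1) vw(1) wV by auto
    have single: "D u = {a}" if "u \<in> Q" "a \<in> D u" for u
    proof -
      have "u \<in> V" using that Q(1) by auto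
      then show ?thesis using True that D_fin[of u] by (metis One_nat_def card_le_Suc0_iff_eq is_singletonI' is_singleton_the_elem singletonD empty_iff)
    qed
    have Ds: "D s = {a}" "D t = {a}" using single[OF s a] single[OF t(1)] D_sym[OF aV(1), of t] Da by simp_all
    define S where "S = insert h (insert a Q)"
    define Y where "Y = {s, t}"
    have "card S \<le> 3 * card Y" using t Q(2) finQ by (simp add: S_def Y_def card_insert_if)
    moreover have "limited V C D (X \<union> Y)" if X: "limited (V - S) (\<lambda>v. C v - S) (\<lambda>v. D v - S) X" for X
    proof (rule extend_limited[OF _ _ X])
      have XS: "X \<inter> S = {}" using X by (auto simp: limited_def)
      show "Y \<subseteq> S" "S \<subseteq> V" using s t V Q(1) aV(1) by (auto simp: S_def Y_def)
      show "C y \<subseteq> S - Y" if "y \<in> Y" for y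
        using that CQ[OF s] CQ[OF t(1)] C_irr[OF V(1)] C_irr[OF V(2)] t(3) C_sym[OF V(2), of s]
        by (auto simp: S_def Y_def)
      fix u assume u: "u \<in> V" "u \<in> S \<or> D u \<inter> Y \<noteq> {}"
      have Du: "s \<in> D u \<Longrightarrow> u = a" "t \<in> D u \<Longrightarrow> u = a"
        using D_sym[OF u(1), of s] D_sym[OF u(1), of t] Ds by simp_all
      have "u \<in> S" using u(2) Du by (auto simp: S_def Y_def)
      then consider "u \<in> Q" | "u = a" | "u = h" by (auto simp: S_def)
      then show "card ((X \<union> Y) \<inter> insert u (D u)) \<le> 2"
      proof cases
        case 1
        then have "card (insert u (D u)) \<le> 2"
          using bspec[OF True 1] D_fin[OF u(1)] by (simp add: card_insert_if)
        then show ?thesis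
          using D_fin[OF u(1)] by - (rule order_trans[OF card_mono[of "insert u (D u)"]], auto)
      next
        case 2
        then have "(X \<union> Y) \<inter> insert u (D u) \<subseteq> {s, t}" using XS aV Da by (auto simp: S_def Y_def)
        then show ?thesis using t(2) by - (rule order_trans[OF card_mono[of "{s, t}"]], auto)
      next
        case 3
        \<comment> \<open>Neither \<open>h\<close> nor its d-neighbour \<open>a\<close> is selected,
          which leaves at most two selected vertices in the star of \<open>h\<close>.\<close>
        have ah: "a \<in> D h" using D_sym[OF aV(1), of h] Da by simp
        have "s \<notin> D u" "t \<notin> D u" "u \<notin> Q" using Du 3 h aV vw by auto
        then have "(X \<union> Y) \<inter> insert u (D u) \<subseteq> D h - {a}"
          using 3 XS s t by (auto simp: S_def Y_def)
        then show ?thesis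
          using D_fin[OF V(3)] card_D_remove[OF V(3) ah] by - (rule order_trans[OF card_mono[of "D h - {a}"]], auto)
      qed
    qed auto
    moreover have "S \<subseteq> V" "S \<noteq> {}" "Y \<subseteq> S" using s t V Q(1) aV(1) by (auto simp: S_def Y_def)
    ultimately show ?thesis by (intro exI[of _ S] exI[of _ Y] conjI allI impI)
  next
    case False
    have "finite ((\<lambda>s. card (D s)) ` Q)" "(\<lambda>s. card (D s)) ` Q \<noteq> {}" using finQ Q(2) by auto
    then have "Max ((\<lambda>s. card (D s)) ` Q) \<in> (\<lambda>s. card (D s)) ` Q" by (rule Max_in)
    then obtain s where s: "s \<in> Q" and "Max ((\<lambda>s. card (D s)) ` Q) = card (D s)" by auto
    then have smax: "card (D y) \<le> card (D s)" if "y \<in> Q" for y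
      using Max_ge[of "(\<lambda>s. card (D s)) ` Q" "card (D y)"] that finQ by simp
    have sV: "s \<in> V" using s Q(1) by auto
    have "\<not> card (D s) \<le> 1" using False smax by (meson le_trans)
    then obtain a b where ab: "a \<in> D s" "b \<in> D s" "a \<noteq> b"
      using D_fin[OF sV] by (auto simp: card_le_Suc0_iff_eq)
    obtain t h where t: "t \<in> Q" "t \<noteq> s" "t \<notin> C s" and h: "h \<in> {v, w}" and Da: "D a = {s, t, h}"
      and aV: "a \<in> V" "a \<notin> Q" "a \<noteq> v" "a \<noteq> w"
      using outer[OF s ab(1)] by auto
    obtain x k where x: "x \<in> Q" "x \<noteq> s" "x \<notin> C s" and k: "k \<in> {v, w}" and Db: "D b = {s, x, k}"
      and bV: "b \<in> V" "b \<notin> Q" "b \<noteq> v" "b \<noteq> w"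
      using outer[OF s ab(2)] by auto
    have tx: "t \<noteq> x" using uniq[OF s t(1,2) ab(1,2)] ab(3) Da Db by auto
    have V: "t \<in> V" "h \<in> V" "x \<in> V" "k \<in> V" using t h x k Q(1) vw(1) wV by auto
    have Ds_out: "D s \<inter> Q = {}" "v \<notin> D s" "w \<notin> D s" using outer_out[OF s] by auto
    have vDw: "v \<in> D w" using D_sym vw by simp
    have two: "card (D y) \<le> 2" if y: "y \<in> Q" "y \<noteq> s" for y
    proof (rule ccontr)
      assume "\<not> card (D y) \<le> 2"
      then have c3: "3 \<le> card (D y)" "3 \<le> card (D s)" using smax[OF y(1)] by auto
      have yV: "y \<in> V" using y Q(1) by auto
      \<comment> \<open>A common d-neighbour of \<open>s\<close> and \<open>y\<close> is a witness
        for this pair, hence unique by \<open>uniq\<close>. So \<open>D s\<close> and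
        \<open>D y\<close> would cover five vertices, all among the at most four further
        d-neighbours of \<open>v\<close> and \<open>w\<close>.\<close>
      have "p = q" if "p \<in> D s \<inter> D y" "q \<in> D s \<inter> D y" for p q
        using uniq[OF s y, of p q] that D_sym[OF yV, of p] D_sym[OF yV, of q] by simp
      then have "card (D s \<inter> D y) \<le> 1" using D_fin[OF sV] by (simp add: card_le_Suc0_iff_eq)
      then have c5: "5 \<le> card (D s \<union> D y)"
        using card_Un_Int[OF D_fin[OF sV] D_fin[OF yV]] c3 by simp
      have "p \<in> (D v - {w}) \<union> (D w - {v})" if "z \<in> Q" "p \<in> D z" for p z
        using outer[OF that] outer_out[OF that] D_sym[of p v] D_sym[of p w] by auto
      then have "D s \<union> D y \<subseteq> (D v - {w}) \<union> (D w - {v})" using s y by blast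
      then have "card (D s \<union> D y) \<le> card ((D v - {w}) \<union> (D w - {v}))"
        using D_fin vw(1) wV by (intro card_mono) auto
      also have "\<dots> \<le> 4"
        using card_Un_le[of "D v - {w}" "D w - {v}"] card_D_remove[OF vw(1,2)] card_D_remove[OF wV vDw]
        by linarith
      finally show False using c5 by simp
    qed
    define S where "S = Q \<union> {v, w} \<union> D s"
    \<comment> \<open>\<open>S\<close> has at most \<open>4 + 2 + 3\<close> vertices. Selecting
      \<open>b\<close> along with its d-neighbour \<open>s\<close> is possible since the rest of
      \<open>D b\<close>, namely \<open>x\<close> and \<open>k\<close>, stays unselected, and since
      \<open>D b\<close> exhausts the degree of \<open>b\<close> and so leaves it no
      c-neighbours.\<close>
    define Y where "Y = {s, t, b}"
    have "b \<noteq> s" "b \<noteq> t" using s t bV by auto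
    then have cY: "card Y = 3" using t(2) by (simp add: Y_def)
    have "card S \<le> 3 * card Y"
      unfolding S_def cY using card_Un_le[of "Q \<union> {v, w}" "D s"] card_Un_le[of Q "{v, w}"]
        card_D[OF sV] Q(2) card_insert_le_m1[of 2 "{w}" v] by simp
    moreover have "limited V C D (X \<union> Y)" if X: "limited (V - S) (\<lambda>v. C v - S) (\<lambda>v. D v - S) X" for X
    proof (rule extend_limited[OF _ _ X])
      have XS: "X \<inter> S = {}" using X by (auto simp: limited_def)
      show "Y \<subseteq> S" "S \<subseteq> V" using s t V Q(1) bV ab vw(1) wV D_sub[OF sV] by (auto simp: S_def Y_def)
      have "k \<noteq> s" "k \<noteq> x" using k s x(1) vw by auto
      then have "card (D b) = 3" using Db x(2) by simp
      then have Cb: "C b = {}" using C_empty[OF bV(1)] by simp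
      have Cs: "b \<notin> C s" "b \<notin> C t" using CQ[OF s] CQ[OF t(1)] bV(2) by auto
      show "C y \<subseteq> S - Y" if "y \<in> Y" for y
        using that CQ[OF s] CQ[OF t(1)] C_irr[OF sV] C_irr[OF V(1)] t(3) C_sym[OF V(1), of s] Cb Cs
        by (auto simp: S_def Y_def)
      have vw_out: "v \<notin> X \<union> Y" "w \<notin> X \<union> Y" using XS vw s t bV by (auto simp: S_def Y_def)
      have Q_out: "y \<notin> X \<union> Y" if "y \<in> Q" "y \<noteq> s" "y \<noteq> t" for y
        using that XS bV by (auto simp: S_def Y_def)
      have D_out: "p \<notin> X \<union> Y" if "p \<in> D s" "p \<noteq> b" for p
        using that XS Ds_out s t by (auto simp: S_def Y_def)
      fix u assume u: "u \<in> V" "u \<in> S \<or> D u \<inter> Y \<noteq> {}"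
      have bound: "card ((X \<union> Y) \<inter> insert u (D u)) \<le> 2" if "(X \<union> Y) \<inter> insert u (D u) \<subseteq> {p, q}" for p q
        using card_mono[OF _ that] card_insert_le_m1[of 2 "{q}" p] by simp
      have bound': "card ((X \<union> Y) \<inter> insert u (D u)) \<le> 2"
        if "u \<notin> X \<union> Y" "z \<in> D u" "z \<notin> X \<union> Y" for z
        using D_fin[OF u(1)] card_D_remove[OF u(1) that(2)] that(1,3)
        by - (rule order_trans[OF card_mono[of "D u - {z}"]], auto)
      show "card ((X \<union> Y) \<inter> insert u (D u)) \<le> 2"
      proof (cases "u \<in> S")
        case True
        then consider "u = s" | "u = t" | "u \<in> Q" "u \<noteq> s" "u \<noteq> t" | "u = v" | "u = w" | "u = b"
          | "u \<in> D s" "u \<noteq> b" by (auto simp: S_def)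
        then show ?thesis
        proof cases
          case 1
          show ?thesis by (rule bound[of s b]) (use 1 D_out in auto)
        next
          case 2
          have "a \<in> D t" using D_sym[OF aV(1), of t] Da by simp
          moreover have "a \<notin> X \<union> Y" using D_out ab by simp
          ultimately have "(X \<union> Y) \<inter> insert u (D u) \<subseteq> insert t (D t - {a})" using 2 by auto
          then have "card ((X \<union> Y) \<inter> insert u (D u)) \<le> card (insert t (D t - {a}))"
            using D_fin[OF V(1)] by (intro card_mono) auto
          also have "\<dots> \<le> Suc (card (D t - {a}))" by (rule card_insert_le_m1) simp_all
          also have "\<dots> \<le> 2" using two[OF t(1,2)] \<open>a \<in> D t\<close> by (simp add: card_Diff_singleton)
          finally show ?thesis .
        next
          case 3
          then have "(X \<union> Y) \<inter> insert u (D u) \<subseteq> D u" using Q_out by auto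
          then show ?thesis using card_mono[OF D_fin[OF u(1)]] two[OF 3(1,2)] le_trans by blast
        next
          case 4
          then show ?thesis using bound'[of w] vw_out vw by simp
        next
          case 5
          then show ?thesis using bound'[of v] vw_out vDw by simp
        next
          case 6
          show ?thesis by (rule bound[of s b]) (use 6 Db Q_out[OF x(1,2)] tx k vw_out in auto)
        next
          case 7
          obtain y g where y: "y \<in> Q" "g \<in> {v, w}" "D u = {s, y, g}" using outer[OF s 7(1)] by auto
          then show ?thesis using bound'[of g] D_out[OF 7] vw_out by auto
        qed
      next
        case False
        \<comment> \<open>All d-neighbours of \<open>s\<close> and \<open>b\<close> lie in
          \<open>S\<close>, so \<open>u\<close> is a d-neighbour of \<open>t\<close>, that is, a
          witness for \<open>t\<close> and some \<open>y \<noteq> s\<close>. Only \<open>u\<close>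
          and \<open>t\<close> can then be selected in its star.\<close>
        have "s \<notin> D u" using False D_sym[OF u(1), of s] by (auto simp: S_def)
        moreover have "b \<notin> D u" using False D_sym[OF u(1), of b] Db s x k by (auto simp: S_def)
        ultimately have "t \<in> D u" using u(2) False by (auto simp: Y_def)
        then have "u \<in> D t" using D_sym[OF u(1)] by simp
        then obtain y g where y: "y \<in> Q" "g \<in> {v, w}" "D u = {t, y, g}" using outer[OF t(1)] by blast
        have "y \<noteq> s" using y \<open>s \<notin> D u\<close> by auto
        then have "z \<notin> X \<union> Y" if "z \<in> D u" "z \<noteq> t" for z using that y Q_out[of z] vw_out by auto
        then show ?thesis by (intro bound[of u t]) auto
      qed
    qed auto
    moreover have "S \<subseteq> V" "S \<noteq> {}" "Y \<subseteq> S"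
      using s t V Q(1) bV ab vw(1) wV D_sub[OF sV] by (auto simp: S_def Y_def)
    ultimately show ?thesis by (intro exI[of _ S] exI[of _ Y] conjI allI impI)
  qed
qed

lemma subcubic_Diff: "subcubic (V - S) (\<lambda>v. C v - S) (\<lambda>v. D v - S)"
proof
  show "card (C v - S) + card (D v - S) \<le> 3" if "v \<in> V - S" for v
    using degree[of v] that C_fin[of v] D_fin[of v] card_mono[of "C v" "C v - S"] card_mono[of "D v" "D v - S"]
    by force
  show "K4_free (V - S) (\<lambda>v. C v - S)" by (rule K4_free_mono[OF K4]) auto
qed (use fin C D graph_on_Diff in auto)

section \<open>Reductions at d-edges\<close>

text \<open>A d-edge with a parallel c-edge uses two of the three edge ends at \<open>v\<close>, so \<open>v\<close> has at most one
  d-neighbour and its star is no restriction.\<close>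

lemma limited_third_if_parallel:
  assumes "\<And>v. v \<in> V \<Longrightarrow> D v \<subseteq> C v"
  shows "\<exists>X. limited V C D X \<and> card V \<le> 3 * card X"
proof -
  have "card (C v) \<le> 3" if "v \<in> V" for v using degree[OF that] by simp
  then obtain X where X: "X \<subseteq> V" "independent C X" "card V \<le> 3 * card X"
    using independent_third[OF fin C _ K4] by auto
  have "card (X \<inter> insert v (D v)) \<le> 2" if v: "v \<in> V" for v
  proof -
    have "card (D v) \<le> 1" using card_mono[OF C_fin[OF v] assms[OF v]] degree[OF v] by simp
    then have "card (insert v (D v)) \<le> 2" using D_fin[OF v] by (simp add: card_insert_if)
    then show ?thesis using D_fin[OF v] by - (rule order_trans[OF card_mono[of "insert v (D v)"]], auto)
  qed
  then show ?thesis using X unfolding limited_def by auto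
qed

text \<open>Both ends of the d-edge \<open>vw\<close> are selected and their neighbourhoods deleted. A deleted vertex with
  one d-neighbour among \<open>v\<close>, \<open>w\<close> then allows only one of its two other d-neighbours to be selected, which
  a new c-edge between these enforces. It uses the two edge ends freed by the deletion.\<close>

lemma d_edge_reducible:
  assumes v: "v \<in> V" and w: "w \<in> D v" "w \<notin> C v"
  shows "\<exists>S Y C'. S \<subseteq> V \<and> S \<noteq> {} \<and> Y \<subseteq> S \<and> card S \<le> 3 * card Y \<and>
    subcubic (V - S) C' (\<lambda>v. D v - S) \<and>
    (\<forall>X. limited (V - S) C' (\<lambda>v. D v - S) X \<longrightarrow> limited V C D (X \<union> Y))"
proof -
  have wV: "w \<in> V" using D_sub[OF v w(1)] .
  have vDw: "v \<in> D w" using D_sym[OF v w(1)] .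
  have vw: "v \<noteq> w" "v \<notin> C w" using D_irr[OF v] w C_sym[OF wV, of v] by auto
  define P where "P = (C v \<union> D v) - {w}"
  define R where "R = (C w \<union> D w) - {v}"
  \<comment> \<open>A common d-neighbour of \<open>v\<close> and \<open>w\<close> already has two
    selected vertices in its star, so its remaining d-neighbours are put into \<open>S\<close> as
    well.\<close>
  define T where "T = D v \<inter> D w"
  define S where "S = {v, w} \<union> (P \<union> R) \<union> (\<Union>a\<in>T. D a - {v, w})"
  define M where "M = {a \<in> P \<union> R. v \<in> D a \<or> w \<in> D a}"
  define C' where "C' s = (C s - S) \<union> {t \<in> V - S. t \<noteq> s \<and> (\<exists>a\<in>M. s \<in> D a \<and> t \<in> D a)}" for s
  define Y where "Y = {v, w}"
  have "P \<subseteq> V" "R \<subseteq> V" using C_sub[OF v] D_sub[OF v] C_sub[OF wV] D_sub[OF wV] by (auto simp: P_def R_def)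
  have TV: "a \<in> V" if "a \<in> T" for a using that D_sub[OF v] by (simp add: T_def)
  have "D a \<subseteq> V" if "a \<in> T" for a using D_sub[OF TV[OF that]] by auto
  then have SV: "S \<subseteq> V" using v wV \<open>P \<subseteq> V\<close> \<open>R \<subseteq> V\<close> by (auto simp: S_def)
  have MV: "a \<in> V" if "a \<in> M" for a using that \<open>P \<subseteq> V\<close> \<open>R \<subseteq> V\<close> by (auto simp: M_def)
  have MS: "a \<in> S" if "a \<in> M" for a using that by (simp add: M_def S_def)
  have Tvw: "v \<in> D a" "w \<in> D a" if "a \<in> T" for a
    using D_sym[OF v, of a] D_sym[OF wV, of a] that by (auto simp: T_def)
  have DT: "D a \<subseteq> S" if "a \<in> T" for a using that by (auto simp: S_def)
  have Nv: "C v \<union> D v \<subseteq> S" "C w \<union> D w \<subseteq> S" by (auto simp: S_def P_def R_def)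
  \<comment> \<open>Each vertex of \<open>T\<close> costs at most one additional vertex, but it lies
    in both \<open>P\<close> and \<open>R\<close> and thus saves one in
    \<open>P \<union> R\<close>.\<close>
  have cS: "card S \<le> 6"
  proof -
    have finPR: "finite P" "finite R" using fin \<open>P \<subseteq> V\<close> \<open>R \<subseteq> V\<close> finite_subset by auto
    have "card (C v \<union> D v) \<le> 3" "card (C w \<union> D w) \<le> 3"
      using card_Un_le degree[OF v] degree[OF wV] le_trans by metis+
    then have "card P \<le> 2" "card R \<le> 2"
      unfolding P_def R_def using w(1) vDw by (simp_all add: card_Diff_singleton)
    moreover have "T \<subseteq> P \<inter> R" using D_irr[OF v] D_irr[OF wV] by (auto simp: T_def P_def R_def)
    then have "card T \<le> card (P \<inter> R)" using finPR by (intro card_mono) auto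
    ultimately have PR: "card (P \<union> R) + card T \<le> 4" using card_Un_Int[OF finPR] by linarith
    have "finite T" using D_fin[OF v] by (simp add: T_def)
    then have "card (\<Union>a\<in>T. D a - {v, w}) \<le> (\<Sum>a\<in>T. card (D a - {v, w}))" by (rule card_UN_le)
    also have "\<dots> \<le> (\<Sum>a\<in>T. 1)"
    proof (rule sum_mono)
      fix a assume a: "a \<in> T"
      then have "card (D a - {v, w}) = card (D a) - 2"
        using Tvw[OF a] vw(1) by (subst card_Diff_subset) auto
      then show "card (D a - {v, w}) \<le> 1" using card_D[OF TV[OF a]] by simp
    qed
    finally have "card (\<Union>a\<in>T. D a - {v, w}) \<le> card T" by simp
    moreover have "card {v, w} = 2" using vw(1) by simp
    ultimately show ?thesis unfolding S_def
      using PR card_Un_le[of "{v, w} \<union> (P \<union> R)" "\<Union>a\<in>T. D a - {v, w}"] card_Un_le[of "{v, w}" "P \<union> R"]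
      by linarith
  qed
  \<comment> \<open>One of the at most three d-neighbours of \<open>a\<close> is \<open>v\<close> or
    \<open>w\<close>, hence in \<open>S\<close>. Besides \<open>s\<close> this leaves at most one,
    so \<open>a\<close> causes at most one new c-edge at \<open>s\<close>.\<close>
  have M_other: "card (D a - S - {s}) \<le> 1" if "a \<in> M" "s \<in> D a" "s \<notin> S" for a s
  proof -
    have "v \<in> D a \<or> w \<in> D a" "v \<in> S" "w \<in> S" using that(1) by (auto simp: M_def S_def)
    then obtain h where h: "h \<in> D a" "h \<in> S" by blast
    have "card (D a - {h} - {s}) \<le> 1"
      using card_D_remove[OF MV[OF that(1)] h(1)] that(2,3) h(2) by (subst card_Diff_singleton) auto
    then show ?thesis using D_fin[OF MV[OF that(1)]] h(2)
      by - (rule order_trans[OF card_mono[of "D a - {h} - {s}"]], auto)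
  qed
  have "graph_on (V - S) C'"
    unfolding graph_on_def
  proof (intro ballI conjI)
    fix s assume s: "s \<in> V - S"
    then show "C' s \<subseteq> V - S - {s}" using C_sub[of s] C_irr[of s] by (auto simp: C'_def)
    fix t assume "t \<in> C' s"
    then show "s \<in> C' t" using s C_sym[of s t] by (auto simp: C'_def)
  qed
  \<comment> \<open>Each new c-edge at \<open>s\<close> is charged to a d-neighbour of
    \<open>s\<close> in \<open>M\<close>, and \<open>M\<close> is contained in \<open>S\<close>, so
    \<open>s\<close> loses at least as many d-neighbours as it gains c-neighbours.\<close>
  moreover have "card (C' s) + card (D s - S) \<le> 3" if s: "s \<in> V - S" for s
  proof -
    have sV: "s \<in> V" using s by simp
    have sub: "{t \<in> V - S. t \<noteq> s \<and> (\<exists>a\<in>M. s \<in> D a \<and> t \<in> D a)} \<subseteq> (\<Union>a\<in>D s \<inter> M. D a - S - {s})"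
    proof
      fix t assume "t \<in> {t \<in> V - S. t \<noteq> s \<and> (\<exists>a\<in>M. s \<in> D a \<and> t \<in> D a)}"
      then obtain a where "t \<notin> S" "t \<noteq> s" "a \<in> M" "s \<in> D a" "t \<in> D a" by auto
      then show "t \<in> (\<Union>a\<in>D s \<inter> M. D a - S - {s})" using D_sym[OF MV] by auto
    qed
    have "card (\<Union>a\<in>D s \<inter> M. D a - S - {s}) \<le> (\<Sum>a\<in>D s \<inter> M. card (D a - S - {s}))"
      using D_fin[OF sV] by (intro card_UN_le) simp
    also have "\<dots> \<le> (\<Sum>a\<in>D s \<inter> M. 1)"
      using M_other D_sym[OF sV] s by (intro sum_mono) auto
    also have "\<dots> \<le> card (D s \<inter> S)"
      using D_fin[OF sV] MS by (auto intro: card_mono)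
    finally have "card (\<Union>a\<in>D s \<inter> M. D a - S - {s}) \<le> card (D s \<inter> S)" .
    moreover have "card {t \<in> V - S. t \<noteq> s \<and> (\<exists>a\<in>M. s \<in> D a \<and> t \<in> D a)} \<le> card (\<Union>a\<in>D s \<inter> M. D a - S - {s})"
      using D_fin[OF sV] D_fin MV by (intro card_mono[OF _ sub]) auto
    moreover have "card (C' s) \<le> card (C s - S) + card {t \<in> V - S. t \<noteq> s \<and> (\<exists>a\<in>M. s \<in> D a \<and> t \<in> D a)}"
      unfolding C'_def by (rule card_Un_le)
    moreover have "card (C s - S) \<le> card (C s)" using C_fin[OF sV] by (intro card_mono) auto
    moreover have "card (D s) = card (D s \<inter> S) + card (D s - S)" using card_Int_Diff[OF D_fin[OF sV]] .
    ultimately show ?thesis using degree[OF sV] by linarith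
  qed
  ultimately have sub': "subcubic (V - S) C' (\<lambda>v. D v - S)" if "K4_free (V - S) C'"
    using that fin graph_on_Diff[OF D] by (intro subcubic.intro) auto
  show ?thesis
  proof (cases "K4_free (V - S) C'")
    case True
    have "limited V C D (X \<union> Y)" if X: "limited (V - S) C' (\<lambda>v. D v - S) X" for X
    proof (rule extend_limited[OF _ SV X])
      have XS: "X \<inter> S = {}" and XV: "X \<subseteq> V" using X by (auto simp: limited_def)
      show YS: "Y \<subseteq> S" by (auto simp: Y_def S_def)
      show "C u - S \<subseteq> C' u" if "u \<in> V - S" for u by (auto simp: C'_def)
      show "C y \<subseteq> S - Y" if "y \<in> Y" for y
        using that Nv w(2) vw(2) C_irr[OF v] C_irr[OF wV] by (auto simp: Y_def)
      fix u assume u: "u \<in> V" "u \<in> S \<or> D u \<inter> Y \<noteq> {}"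
      have DY: "h \<in> D u \<Longrightarrow> u \<in> D h" for h using D_sym[OF u(1)] .
      have uS: "u \<in> S" using u(2) DY[of v] DY[of w] Nv by (auto simp: Y_def)
      have bound: "card ((X \<union> Y) \<inter> insert u (D u)) \<le> 2" if "(X \<union> Y) \<inter> insert u (D u) \<subseteq> {v, w}"
        using card_mono[OF _ that] vw(1) by simp
      have one: "s = t" if "a \<in> M" "s \<in> X \<inter> D a" "t \<in> X \<inter> D a" for a s t
      proof (rule ccontr)
        assume "s \<noteq> t"
        then have "t \<in> C' s" using that XS XV by (auto simp: C'_def)
        then show False using X that unfolding limited_def independent_def by auto
      qed
      consider "u \<in> Y" | "u \<notin> Y" "u \<in> T" | h where "u \<notin> Y" "u \<notin> T" "h \<in> Y" "h \<in> D u" | "u \<notin> Y" "D u \<inter> Y = {}"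
        by blast
      then show "card ((X \<union> Y) \<inter> insert u (D u)) \<le> 2"
      proof cases
        case 1
        then show ?thesis using Nv XS YS by (intro bound) (auto simp: Y_def)
      next
        case 2
        then show ?thesis using DT XS uS by (intro bound) (auto simp: Y_def)
      next
        case 3
        have uM: "u \<in> M" using 3 DY[of h] by (auto simp: M_def P_def R_def Y_def)
        have "D u \<inter> Y = {h}" using 3 DY by (auto simp: Y_def T_def)
        then have "(X \<union> Y) \<inter> insert u (D u) \<subseteq> insert h (X \<inter> D u)" using 3 XS uS by auto
        moreover have "card (X \<inter> D u) \<le> 1"
          using one[OF uM] D_fin[OF u(1)] by (simp add: card_le_Suc0_iff_eq)
        then have "card (insert h (X \<inter> D u)) \<le> 2" using D_fin[OF u(1)] by (simp add: card_insert_if)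
        ultimately show ?thesis using D_fin[OF u(1)]
          by - (rule order_trans[OF card_mono[of "insert h (X \<inter> D u)"]], auto)
      next
        case 4
        have uv: "v \<notin> D u" "w \<notin> D u" "u \<notin> D v" "u \<notin> D w" "u \<noteq> v" "u \<noteq> w"
          using 4 D_sym[OF v, of u] D_sym[OF wV, of u] by (auto simp: Y_def)
        \<comment> \<open>Either a c-edge to \<open>v\<close> or \<open>w\<close> takes up part of
          the degree of \<open>u\<close>, or \<open>u\<close> was deleted as a d-neighbour of some
          \<open>a\<close> in \<open>T\<close>, and then \<open>a\<close> is a d-neighbour of
          \<open>u\<close> inside \<open>S\<close>.\<close>
        have "card (D u - S) \<le> 2"
        proof (cases "u \<in> P \<union> R")
          case True
          then have "u \<in> C v \<or> u \<in> C w" using uv by (auto simp: P_def R_def)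
          then have "C u \<noteq> {}" using C_sym[OF v, of u] C_sym[OF wV, of u] by auto
          then have "card (D u) \<le> 2" using C_empty[OF u(1)] by force
          then show ?thesis using D_fin[OF u(1)] by - (rule order_trans[OF card_mono[of "D u"]], auto)
        next
          case False
          then obtain a where a: "a \<in> T" "u \<in> D a" using uS uv by (auto simp: S_def)
          have "a \<in> S" using a(1) D_irr[OF wV] by (auto simp: T_def S_def P_def)
          moreover have "a \<in> D u" using D_sym[OF TV[OF a(1)] a(2)] .
          ultimately show ?thesis using D_fin[OF u(1)] card_D_remove[OF u(1)]
            by - (rule order_trans[OF card_mono[of "D u - {a}"]], auto)
        qed
        moreover have "(X \<union> Y) \<inter> insert u (D u) \<subseteq> D u - S" using XS uS 4 by auto
        ultimately show ?thesis using D_fin[OF u(1)]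
          by - (rule order_trans[OF card_mono[of "D u - S"]], auto)
      qed
    qed
    moreover have "card S \<le> 3 * card Y" using cS vw(1) by (simp add: Y_def)
    moreover have "S \<noteq> {}" "Y \<subseteq> S" by (auto simp: S_def Y_def)
    ultimately show ?thesis using SV sub'[OF True] by (intro exI[of _ S] exI[of _ Y] exI[of _ C'] conjI allI impI)
  next
    case False
    then obtain Q where Q: "Q \<subseteq> V - S" "card Q = 4" "\<forall>u\<in>Q. Q - {u} \<subseteq> C' u"
      unfolding K4_free_def by metis
    \<comment> \<open>A different set is deleted now. The edges of the K4 that are missing in
      \<open>C\<close> are new, so vertices of \<open>M\<close> witness them; the resulting deletion
      adds no edge, and \<open>subcubic_Diff\<close> applies.\<close>
    have "\<exists>S Y. S \<subseteq> V \<and> S \<noteq> {} \<and> Y \<subseteq> S \<and> card S \<le> 3 * card Y \<and>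
      (\<forall>X. limited (V - S) (\<lambda>v. C v - S) (\<lambda>v. D v - S) X \<longrightarrow> limited V C D (X \<union> Y))"
    proof (rule K4_reducible[OF _ Q(2) v w(1)])
      show "Q \<subseteq> V" "v \<notin> Q" "w \<notin> Q" using Q(1) by (auto simp: S_def)
      fix s t assume st: "s \<in> Q" "t \<in> Q" "s \<noteq> t" "t \<notin> C s"
      have "t \<in> C' s" using bspec[OF Q(3) st(1)] st by auto
      then obtain a where a: "a \<in> M" "s \<in> D a" "t \<in> D a" using st(4) by (auto simp: C'_def)
      have "a \<noteq> v" "a \<noteq> w" using a(2) Nv st(1) Q(1) by auto
      moreover have "a \<notin> Q" using MS[OF a(1)] Q(1) by auto
      ultimately have "a \<in> V - Q - {v, w}" using MV[OF a(1)] by simp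
      moreover have "\<exists>h\<in>{v, w}. {s, t, h} \<subseteq> D a" using a by (simp add: M_def)
      ultimately show "\<exists>a\<in>V - Q - {v, w}. \<exists>h\<in>{v, w}. {s, t, h} \<subseteq> D a" by (rule bexI[rotated])
    qed
    then show ?thesis using subcubic_Diff by metis
  qed
qed

end

theorem limited_third:
  assumes "subcubic V C D"
  shows "\<exists>X. limited V C D X \<and> card V \<le> 3 * card X"
  using assms
proof (induction "card V" arbitrary: V C D rule: less_induct)
  case less
  interpret subcubic V C D by (rule less.prems)
  show ?case
  proof (cases "\<forall>v\<in>V. D v \<subseteq> C v")
    case True
    then show ?thesis by (intro limited_third_if_parallel) simp
  next
    case False
    then obtain v w where vw: "v \<in> V" "w \<in> D v" "w \<notin> C v" by auto
    obtain S Y C' where S: "S \<subseteq> V" "S \<noteq> {}" "Y \<subseteq> S" "card S \<le> 3 * card Y"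
      and sub: "subcubic (V - S) C' (\<lambda>v. D v - S)"
      and ext: "\<forall>X. limited (V - S) C' (\<lambda>v. D v - S) X \<longrightarrow> limited V C D (X \<union> Y)"
      using d_edge_reducible[OF vw] by (elim exE conjE)
    have "card (V - S) < card V" using S(1,2) fin by (intro psubset_card_mono) auto
    then obtain X where X: "limited (V - S) C' (\<lambda>v. D v - S) X" "card (V - S) \<le> 3 * card X"
      using less.hyps[OF _ sub] by auto
    have XS: "X \<subseteq> V - S" using X(1) by (simp add: limited_def)
    have finS: "finite S" "finite X" "finite Y" using S(1,3) XS fin by (meson finite_Diff finite_subset)+
    have "card (X \<union> Y) = card X + card Y"
      using finS XS S(3) by (intro card_Un_disjoint) auto
    moreover have "card V = card (V - S) + card S"
      using card_Diff_subset[OF finS(1) S(1)] card_mono[OF fin S(1)] by simp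
    ultimately have "card V \<le> 3 * card (X \<union> Y)" using X(2) S(4) by linarith
    then show ?thesis using ext X(1) by auto
  qed
qed

section \<open>Multigraphs\<close>

definition typed_nbrs :: "('v, 'e) typed_multigraph \<Rightarrow> edge_type \<Rightarrow> 'v \<Rightarrow> 'v set" where
  "typed_nbrs G ty v = {u. \<exists>e \<in> edges G. etype G e = ty \<and> ends G e = {u, v}}"

definition other_end :: "('v, 'e) typed_multigraph \<Rightarrow> 'v \<Rightarrow> 'e \<Rightarrow> 'v" where
  "other_end G v e = the_elem (ends G e - {v})"

lemma closed_d_nbhd_eq: "closed_d_nbhd G v = insert v (typed_nbrs G DEdge v)"
  by (simp add: closed_d_nbhd_def typed_nbrs_def)

locale subcubic_multigraph = finite_loopless_multigraph G for G :: "('v, 'e) typed_multigraph" +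
  assumes degree_le: "v \<in> verts G \<Longrightarrow> degree G v \<le> 3"
begin

lemma ends_neq: "e \<in> edges G \<Longrightarrow> ends G e = {u, v} \<Longrightarrow> u \<noteq> v"
  using loopless[of e] by auto

lemma graph_on_typed_nbrs: "graph_on (verts G) (typed_nbrs G ty)"
  unfolding graph_on_def
proof (intro ballI conjI)
  fix v assume "v \<in> verts G"
  show "typed_nbrs G ty v \<subseteq> verts G - {v}"
  proof
    fix u assume "u \<in> typed_nbrs G ty v"
    then obtain e where e: "e \<in> edges G" "ends G e = {u, v}" by (auto simp: typed_nbrs_def)
    show "u \<in> verts G - {v}" using ends_in_verts[OF e(1)] ends_neq[OF e] e(2) by simp
  qed
  fix u assume "u \<in> typed_nbrs G ty v"
  then show "v \<in> typed_nbrs G ty u" by (simp add: typed_nbrs_def insert_commute)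
qed

lemma typed_nbrs_subset: "typed_nbrs G ty v \<subseteq> other_end G v ` {e \<in> edges G. v \<in> ends G e \<and> etype G e = ty}"
proof
  fix u assume "u \<in> typed_nbrs G ty v"
  then obtain e where e: "e \<in> edges G" "etype G e = ty" "ends G e = {u, v}" by (auto simp: typed_nbrs_def)
  then have "ends G e - {v} = {u}" using ends_neq[OF e(1,3)] by auto
  then have "u = other_end G v e" by (simp add: other_end_def)
  then show "u \<in> other_end G v ` {e \<in> edges G. v \<in> ends G e \<and> etype G e = ty}" using e by auto
qed

lemma card_typed_nbrs: "card (typed_nbrs G ty v) \<le> card {e \<in> edges G. v \<in> ends G e \<and> etype G e = ty}"
  using finite_edges by (intro surj_card_le[OF _ typed_nbrs_subset]) simp

lemma degree_split:
  "degree G v = card {e \<in> edges G. v \<in> ends G e \<and> etype G e = CEdge} +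
    card {e \<in> edges G. v \<in> ends G e \<and> etype G e = DEdge}"
proof -
  have "{e \<in> edges G. v \<in> ends G e} = {e \<in> edges G. v \<in> ends G e \<and> etype G e = CEdge} \<union>
      {e \<in> edges G. v \<in> ends G e \<and> etype G e = DEdge}"
    by (auto intro: edge_type.exhaust)
  then show ?thesis unfolding degree_def using finite_edges by (simp add: card_Un_disjoint disjoint_iff)
qed

lemma other_end:
  assumes "e \<in> edges G" "v \<in> ends G e"
  shows "ends G e = {other_end G v e, v}"
proof -
  obtain a b where ab: "ends G e = {a, b}" "a \<noteq> b" using loopless[OF assms(1)] by (auto simp: card_2_iff)
  then have "v = a \<or> v = b" using assms(2) by simp
  then show ?thesis
  proof
    assume v: "v = a"
    then have "ends G e - {v} = {b}" using ab by auto
    then show ?thesis using ab(1) v by (simp add: other_end_def insert_commute)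
  next
    assume v: "v = b"
    then have "ends G e - {v} = {a}" using ab by auto
    then show ?thesis using ab(1) v by (simp add: other_end_def)
  qed
qed

section \<open>Components that are a K4 of c-edges\<close>

text \<open>Three distinct c-neighbours use up the degree of each vertex of \<open>Q\<close>. So no
  edge leaves \<open>Q\<close>, and inside there are neither d-edges nor parallel edges.\<close>

lemma K4_component:
  assumes "\<not> K4_free (verts G) (typed_nbrs G CEdge)"
  shows "\<exists>H \<in> components G. isomorphic H (complete_graph 4) \<and> (\<forall>e \<in> edges H. etype H e = CEdge)"
proof -
  obtain Q where Q: "Q \<subseteq> verts G" "card Q = 4" "\<forall>u\<in>Q. Q - {u} \<subseteq> typed_nbrs G CEdge u"
    using assms unfolding K4_free_def by metis
  have finQ: "finite Q" using Q(1) finite_verts finite_subset by blast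
  \<comment> \<open>The three other vertices of \<open>Q\<close> need three c-edges at
    \<open>v\<close>, while \<open>v\<close> has at most three edges of any type. Equality
    throughout makes all of them c-edges with distinct other ends.\<close>
  have at: "inj_on (other_end G v) {e \<in> edges G. v \<in> ends G e} \<and>
      other_end G v ` {e \<in> edges G. v \<in> ends G e} = Q - {v} \<and>
      (\<forall>e\<in>edges G. v \<in> ends G e \<longrightarrow> etype G e = CEdge)" if v: "v \<in> Q" for v
  proof -
    define I where "I = {e \<in> edges G. v \<in> ends G e}"
    define J where "J = {e \<in> edges G. v \<in> ends G e \<and> etype G e = CEdge}"
    have fin: "finite I" "finite J" and JI: "J \<subseteq> I" using finite_edges by (auto simp: I_def J_def)
    have c3: "card (Q - {v}) = 3" using v Q(2) by (simp add: card_Diff_singleton)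
    have QJ: "Q - {v} \<subseteq> other_end G v ` J"
      using bspec[OF Q(3) v] typed_nbrs_subset[of CEdge v] unfolding J_def by (rule order_trans)
    have "3 \<le> card (other_end G v ` J)" using card_mono[OF _ QJ] c3 fin by simp
    then have J3: "3 \<le> card J" using card_image_le[OF fin(2), of "other_end G v"] by linarith
    have I3: "card I \<le> 3" using degree_le[of v] v Q(1) by (auto simp: I_def degree_def)
    have IJ: "J = I" using card_seteq[OF fin(1) JI] J3 I3 by simp
    have img: "Q - {v} = other_end G v ` I"
      using QJ c3 card_image_le[OF fin(1), of "other_end G v"] I3 fin(1) unfolding IJ
      by (intro card_seteq) auto
    have "inj_on (other_end G v) I"
      using img c3 J3 I3 IJ fin(1) by (intro eq_card_imp_inj_on) auto
    then show ?thesis using img IJ by (auto simp: I_def J_def)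
  qed
  have ends_Q: "ends G e \<subseteq> Q" if "e \<in> edges G" "v \<in> ends G e" "v \<in> Q" for e v
  proof -
    have "other_end G v e \<in> other_end G v ` {e \<in> edges G. v \<in> ends G e}" using that(1,2) by simp
    then have "other_end G v e \<in> Q" using at[OF that(3)] by simp
    then show ?thesis using other_end[OF that(1,2)] that(3) by simp
  qed
  \<comment> \<open>The isomorphism has to respect multiplicities, so parallel edges inside
    \<open>Q\<close> must be ruled out.\<close>
  have ends_inj: "e = e'" if e: "e \<in> edges G" "e' \<in> edges G" "ends G e = ends G e'" "ends G e \<subseteq> Q" for e e'
  proof -
    have "ends G e \<noteq> {}" using loopless[OF e(1)] by auto
    then obtain v where v: "v \<in> ends G e" by auto
    have "other_end G v e = other_end G v e'" using e(3) by (simp add: other_end_def)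
    moreover have "inj_on (other_end G v) {e \<in> edges G. v \<in> ends G e}" using at v e(4) by auto
    ultimately show ?thesis using e v by (auto dest: inj_onD)
  qed
  have edge: "\<exists>e\<in>edges G. ends G e = {a, b}" if "a \<in> Q" "b \<in> Q" "a \<noteq> b" for a b
  proof -
    have "a \<in> typed_nbrs G CEdge b" using bspec[OF Q(3) that(2)] that(1,3) by auto
    then show ?thesis by (auto simp: typed_nbrs_def)
  qed
  obtain u where u: "u \<in> Q" using Q(2) by fastforce
  have "{x \<in> verts G. (adjacent G)\<^sup>*\<^sup>* u x} = Q"
  proof
    have "x \<in> Q" if "(adjacent G)\<^sup>*\<^sup>* u x" for x
      using that
    proof (induction rule: rtranclp_induct)
      case (step y z)
      then obtain e where "e \<in> edges G" "ends G e = {y, z}" by (auto simp: adjacent_def)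
      then show ?case using ends_Q[of e y] step.IH by simp
    qed (use u in simp)
    then show "{x \<in> verts G. (adjacent G)\<^sup>*\<^sup>* u x} \<subseteq> Q" by auto
    have "(adjacent G)\<^sup>*\<^sup>* u x" if "x \<in> Q" for x
    proof (cases "x = u")
      case False
      then have "adjacent G u x" using edge[OF u that] by (simp add: adjacent_def)
      then show ?thesis by (rule r_into_rtranclp)
    qed simp
    then show "Q \<subseteq> {x \<in> verts G. (adjacent G)\<^sup>*\<^sup>* u x}" using Q(1) by auto
  qed
  then have comp: "induced_subgraph G Q \<in> components G" using u Q(1) unfolding components_def by blast
  have types: "\<forall>e \<in> edges (induced_subgraph G Q). etype (induced_subgraph G Q) e = CEdge"
  proof
    fix e assume "e \<in> edges (induced_subgraph G Q)"
    then have e: "e \<in> edges G" "ends G e \<subseteq> Q" by (auto simp: induced_subgraph_def)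
    have "ends G e \<noteq> {}" using loopless[OF e(1)] by auto
    then obtain v where "v \<in> ends G e" "v \<in> Q" using e(2) by auto
    then show "etype (induced_subgraph G Q) e = CEdge" using at e(1) by (simp add: induced_subgraph_def)
  qed
  obtain f where f: "bij_betw f Q {..<4::nat}"
    using ex_bij_betw_finite_nat[OF finQ] Q(2) by (auto simp: atLeast0LessThan)
  have f_inj: "inj_on f Q" and f_img: "f ` Q = {..<4}" using f by (auto simp: bij_betw_def)
  have "bij_betw (\<lambda>e. f ` ends G e) {e \<in> edges G. ends G e \<subseteq> Q} {p. p \<subseteq> {..<4} \<and> card p = 2}"
    unfolding bij_betw_def
  proof (intro conjI)
    show "inj_on (\<lambda>e. f ` ends G e) {e \<in> edges G. ends G e \<subseteq> Q}"
      using ends_inj inj_on_image_eq_iff[OF f_inj] by (intro inj_onI) simp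
    show "(\<lambda>e. f ` ends G e) ` {e \<in> edges G. ends G e \<subseteq> Q} = {p. p \<subseteq> {..<4} \<and> card p = 2}" (is "?L = ?R")
    proof
      have "card (f ` ends G e) = 2" if "e \<in> edges G" "ends G e \<subseteq> Q" for e
        using card_image[OF inj_on_subset[OF f_inj that(2)]] loopless[OF that(1)] by simp
      then show "?L \<subseteq> ?R" using f_img by auto
      show "?R \<subseteq> ?L"
      proof
        fix p assume p: "p \<in> ?R"
        then obtain i j where ij: "p = {i, j}" "i \<noteq> j" by (auto simp: card_2_iff)
        then have "i \<in> f ` Q" "j \<in> f ` Q" using p f_img by auto
        then obtain a b where ab: "a \<in> Q" "b \<in> Q" "i = f a" "j = f b" by auto
        then obtain e where "e \<in> edges G" "ends G e = {a, b}" using edge[of a b] ij by auto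
        then show "p \<in> ?L" using ab ij by (intro image_eqI[of _ _ e]) auto
      qed
    qed
  qed
  then have "isomorphic (induced_subgraph G Q) (complete_graph 4)"
    unfolding isomorphic_def using f
    by (intro exI[of _ f] exI[of _ "\<lambda>e. f ` ends G e"])
      (simp add: induced_subgraph_def complete_graph_def)
  then show ?thesis using comp types by blast
qed

end

theorem theorem2p1:
  fixes G :: "('v, 'e) typed_multigraph"
  assumes "finite_loopless_multigraph G"
    and "\<forall>v \<in> verts G. degree G v \<le> 3"
    and "\<not> (\<exists>H \<in> components G. isomorphic H (complete_graph 4) \<and>
              (\<forall>e \<in> edges H. etype H e = CEdge))"
  shows "\<exists>X. two_limited G X \<and> real (card X) \<ge> real (card (verts G)) / 3"
proof -
  interpret subcubic_multigraph G
    using assms(1,2) by (simp add: subcubic_multigraph_def subcubic_multigraph_axioms_def)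
  \<comment> \<open>Parallel edges of one type collapse to a single neighbour, so the two neighbour
    counts sum to at most the degree.\<close>
  have "subcubic (verts G) (typed_nbrs G CEdge) (typed_nbrs G DEdge)"
  proof
    show "card (typed_nbrs G CEdge v) + card (typed_nbrs G DEdge v) \<le> 3" if "v \<in> verts G" for v
      using card_typed_nbrs[of CEdge v] card_typed_nbrs[of DEdge v] degree_split[of v] degree_le[OF that]
      by linarith
    show "K4_free (verts G) (typed_nbrs G CEdge)" using K4_component assms(3) by blast
  qed (rule finite_verts graph_on_typed_nbrs)+
  then obtain X where X: "limited (verts G) (typed_nbrs G CEdge) (typed_nbrs G DEdge) X"
    "card (verts G) \<le> 3 * card X"
    using limited_third by blast
  have "card (X \<inter> ends G e) \<le> 1" if e: "e \<in> edges G" "etype G e = CEdge" for e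
  proof -
    obtain a b where ab: "ends G e = {a, b}" "a \<noteq> b" using loopless[OF e(1)] by (auto simp: card_2_iff)
    then have "a \<in> typed_nbrs G CEdge b" using e by (auto simp: typed_nbrs_def)
    then have "a \<notin> X \<or> b \<notin> X" using X(1) unfolding limited_def independent_def by auto
    then have "X \<inter> ends G e \<subseteq> {a} \<or> X \<inter> ends G e \<subseteq> {b}" using ab(1) by auto
    then show ?thesis using card_mono[of "{a}" "X \<inter> ends G e"] card_mono[of "{b}" "X \<inter> ends G e"] by auto
  qed
  then have "two_limited G X"
    using X(1) by (simp add: two_limited_def limited_def closed_d_nbhd_eq)
  moreover have "real (card X) \<ge> real (card (verts G)) / 3" using X(2) by linarith
  ultimately show ?thesis by blast
qed

end
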